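(* Let $M$ be a smooth manifold with two complex structures $I_\pm$, $X_\pm=(M,I_\pm)$, and let $(\mathcal E_\pm,\mathcal A_\pm,\mathcal B_\pm)$ be holomorphic exact Manin triples over $X_\pm$, with $\mathcal E_\pm$ in the normal form given by closed 3-forms $\mathcal H_\pm\in\Omega^{2,1}(M,I_\pm)\oplus\Omega^{3,0}(M,I_\pm)$. Suppose there are real 2-forms $F_1,F_2\in\Omega^2(M,\mathbb R)$ with $$\mathcal H_+-\mathcal H_-=d(iF_1),\qquad \overline{\mathcal H_-}-\mathcal H_+=d(iF_2),$$ such that the matched pairs satisfy $$L_{\mathcal A_+}=e^{iF_1}L_{\mathcal A_-},\qquad \overline{L_{\mathcal B_-}}=e^{iF_2}L_{\mathcal B_+}.$$ Set $F_\pm=\tfrac12(-F_1\pm F_2)$, with components of type $(1,1)$ and $(2,0)+(0,2)$ for $I_\pm$ respectively $$\omega_\pm=\tfrac12(F_\pm+I_\pm^*F_\pm I_\pm),\qquad \beta_\pm=\tfrac12(F_\pm-I_\pm^*F_\pm I_\pm).$$ Then in the decomposition into symmetric and skew-symmetric parts $$-F_\pm I_\pm=-\omega_\pm I_\pm-\beta_\pm I_\pm=g_\pm+b_\pm$$ we have the coincidences $$g_+=g_-=:g,\qquad b_+=-b_-=:b,$$ and, with $H=\mathrm{Re}(\mathcal H_+)-db=\mathrm{Re}(\mathcal H_-)-db$, $$\pm d^c_\pm\omega_\pm=H.$$ That is, $(g,I_+,I_-)$ is a generalized Kähler structure, provided that $g$ is positive-definite.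
   Context: Bilinear forms are viewed as maps $TM\to T^*M$; $d^c_\pm=i(\bar\partial_\pm-\partial_\pm)$ for $I_\pm$. A generalized Kähler structure consists of a Riemannian metric $g$ and two $g$-orthogonal complex structures $I_\pm$ such that $\omega_\pm=gI_\pm$ satisfy $d^c_+\omega_+=-d^c_-\omega_-=H$ with $H$ a closed 3-form. $\mathbb T_{\mathbb C}M=T_{\mathbb C}M\oplus T^*_{\mathbb C}M$ has the pairing $\langle X+\alpha,Y+\beta\rangle=\iota_X\beta+\iota_Y\alpha$ and, for a closed 3-form $\mathcal H$, the bracket $[X+\alpha,Y+\beta]_{\mathcal H}=[X,Y]+\mathcal L_X\beta-\iota_Yd\alpha+\iota_X\iota_Y\mathcal H$; for a 2-form $B$, $e^B(X+\alpha)=X+\alpha+B(X)$, which maps $[\cdot,\cdot]_{\mathcal H}$ to $[\cdot,\cdot]_{\mathcal H+dB}$. A closed form $\mathcal H\in\Omega^{2,1}(X)\oplus\Omega^{3,0}(X)$ on a complex manifold $X$ defines a holomorphic exact Courant algebroid $\mathcal E$ on $\mathbb T_{1,0}X=T_{1,0}X\oplus T^*_{1,0}X$, whose Dolbeault operator is $\overline D_X(Y+\beta)=\pi_{1,0}[X,Y+\beta]_{\mathcal H}$ for $X\in T_{0,1}X$ and whose bracket on holomorphic sections is $\pi_{1,0}[\cdot,\cdot]_{\mathcal H}$, $\pi_{1,0}:\mathbb T_{\mathbb C}X\to\mathbb T_{1,0}X$ the projection; every holomorphic exact Courant algebroid has this form up to isomorphism. A holomorphic Dirac structure is a maximal isotropic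 holomorphic subbundle closed under the bracket, and a holomorphic exact Manin triple $(\mathcal E,\mathcal A,\mathcal B)$ consists of a holomorphic exact Courant algebroid and holomorphic Dirac structures with $\mathcal E=\mathcal A\oplus\mathcal B$. The matched pair of a holomorphic Dirac structure $\mathcal A$ is the smooth complex Dirac structure $L_{\mathcal A}=\mathcal A\oplus T_{0,1}X\subset(\mathbb T_{\mathbb C}X,[\cdot,\cdot]_{\mathcal H})$. *)

theory Defs
  imports "HOL-Analysis.Analysis"
begin

section \<open>Smooth maps between normed spaces\<close>

text \<open>Being \<open>k\<close> times continuously differentiable on an open set, by iterated directional derivatives.\<close>

primrec Ck_on :: "nat \<Rightarrow> 'a::real_normed_vector set \<Rightarrow> ('a \<Rightarrow> 'b::real_normed_vector) \<Rightarrow> bool" where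
  "Ck_on 0 S f \<longleftrightarrow> continuous_on S f"
| "Ck_on (Suc k) S f \<longleftrightarrow>
     (\<forall>x\<in>S. f differentiable (at x)) \<and> (\<forall>v. Ck_on k S (\<lambda>x. frechet_derivative f (at x) v))"

definition smooth_on :: "'a::real_normed_vector set \<Rightarrow> ('a \<Rightarrow> 'b::real_normed_vector) \<Rightarrow> bool" where
  "smooth_on S f \<longleftrightarrow> (\<forall>k. Ck_on k S f)"

section \<open>Smooth manifolds and tangent vectors\<close>

text \<open>A chart is an open set with a coordinate map. The manifold is the whole type \<open>'m\<close>, with a
  (not necessarily maximal) smooth atlas.\<close>

type_synonym ('m, 'n) chart = "'m set \<times> ('m \<Rightarrow> real^'n)"
type_synonym ('m, 'n) atlas = "('m, 'n) chart set"

definition chart_inv :: "('m, 'n::finite) chart \<Rightarrow> real^'n \<Rightarrow> 'm" where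
  "chart_inv c = inv_into (fst c) (snd c)"

definition smooth_atlas ::
  "('m::{t2_space,second_countable_topology}, 'n::finite) atlas \<Rightarrow> bool" where
  "smooth_atlas M \<longleftrightarrow>
     (\<Union>c\<in>M. fst c) = UNIV \<and>
     (\<forall>c\<in>M. open (fst c) \<and> open (snd c ` fst c) \<and>
        homeomorphism (fst c) (snd c ` fst c) (snd c) (chart_inv c)) \<and>
     (\<forall>c\<in>M. \<forall>c'\<in>M. smooth_on (snd c ` (fst c \<inter> fst c')) (snd c' \<circ> chart_inv c))"

text \<open>Each point gets a preferred chart, and the type \<open>real^'n\<close> serves as the tangent space at
  every point \<open>p\<close>: a vector stands for the tangent vector having these components in the preferred
  chart at \<open>p\<close>. The preferred chart changes discontinuously from point to point, so that smoothness
  and derivatives are always expressed after passing to the components in one fixed chart, by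
  means of the Jacobians \<open>tchange\<close>.\<close>

definition chart_at :: "('m, 'n::finite) atlas \<Rightarrow> 'm \<Rightarrow> ('m, 'n) chart" where
  "chart_at M p = (SOME c. c \<in> M \<and> p \<in> fst c)"

definition tchange ::
  "('m, 'n::finite) chart \<Rightarrow> ('m, 'n) chart \<Rightarrow> 'm \<Rightarrow> real^'n \<Rightarrow> real^'n" where
  "tchange c c' p = frechet_derivative (snd c' \<circ> chart_inv c) (at (snd c p))"

text \<open>\<open>to_chart M c p\<close> sends a tangent vector at \<open>p\<close> to its components in \<open>c\<close>, and
  \<open>from_chart M c p\<close> is the inverse.\<close>

definition to_chart :: "('m, 'n::finite) atlas \<Rightarrow> ('m, 'n) chart \<Rightarrow> 'm \<Rightarrow> real^'n \<Rightarrow> real^'n" where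
  "to_chart M c p = tchange (chart_at M p) c p"

definition from_chart :: "('m, 'n::finite) atlas \<Rightarrow> ('m, 'n) chart \<Rightarrow> 'm \<Rightarrow> real^'n \<Rightarrow> real^'n" where
  "from_chart M c p = tchange c (chart_at M p) p"

section \<open>Covariant tensors, differential forms, exterior derivative\<close>

text \<open>A covariant \<open>k\<close>-tensor field, real or complex valued, is evaluated on lists of \<open>k\<close> tangent
  vectors; its value is 0 on lists of any other length. Thus \<open>F p [X, Y]\<close> is
  \<open>F(X, Y)\<close> at \<open>p\<close>, and the associated map from vectors to covectors is
  \<open>X \<mapsto> F(X, _)\<close>.\<close>

type_synonym ('m, 'n, 'v) tensor = "'m \<Rightarrow> (real^'n) list \<Rightarrow> 'v"

definition coord_tensor ::
  "('m, 'n::finite) atlas \<Rightarrow> ('m, 'n) chart \<Rightarrow> ('m, 'n, 'v) tensor \<Rightarrow>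
     real^'n \<Rightarrow> (real^'n) list \<Rightarrow> 'v" where
  "coord_tensor M c \<alpha> x vs = (let q = chart_inv c x in \<alpha> q (map (from_chart M c q) vs))"

definition smooth_tensor ::
  "('m, 'n::finite) atlas \<Rightarrow> nat \<Rightarrow> ('m, 'n, 'v::real_normed_vector) tensor \<Rightarrow> bool" where
  "smooth_tensor M k \<alpha> \<longleftrightarrow>
     (\<forall>p vs. length vs \<noteq> k \<longrightarrow> \<alpha> p vs = 0) \<and>
     (\<forall>p vs i. length vs = k \<and> i < k \<longrightarrow> linear (\<lambda>v. \<alpha> p (vs[i := v]))) \<and>
     (\<forall>c\<in>M. \<forall>vs. length vs = k \<longrightarrow>
        smooth_on (snd c ` fst c) (\<lambda>x. coord_tensor M c \<alpha> x vs))"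

definition smooth_form ::
  "('m, 'n::finite) atlas \<Rightarrow> nat \<Rightarrow> ('m, 'n, 'v::real_normed_vector) tensor \<Rightarrow> bool" where
  "smooth_form M k \<alpha> \<longleftrightarrow> smooth_tensor M k \<alpha> \<and>
     (\<forall>p vs i j. length vs = k \<and> i < j \<and> j < k \<and> vs ! i = vs ! j \<longrightarrow> \<alpha> p vs = 0)"

text \<open>At \<open>p\<close> the preferred chart is used, in which the tangent vectors at \<open>p\<close> are their own
  components: \<open>d\<alpha>(v\<^sub>0, \<dots>, v\<^sub>k)\<close> is the alternating sum of the derivatives along \<open>v\<^sub>i\<close> of
  \<open>\<alpha>\<close> on the remaining vectors, extended with constant components.\<close>

definition ext_d ::
  "('m, 'n::finite) atlas \<Rightarrow> ('m, 'n, 'v::real_normed_vector) tensor \<Rightarrow> ('m, 'n, 'v) tensor" where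
  "ext_d M \<alpha> p vs = (\<Sum>i<length vs. (-1) ^ i *\<^sub>R
     frechet_derivative
       (\<lambda>x. coord_tensor M (chart_at M p) \<alpha> x (take i vs @ drop (Suc i) vs))
       (at (snd (chart_at M p) p)) (vs ! i))"

definition closed_form ::
  "('m, 'n::finite) atlas \<Rightarrow> ('m, 'n, 'v::real_normed_vector) tensor \<Rightarrow> bool" where
  "closed_form M \<alpha> \<longleftrightarrow> (\<forall>p vs. ext_d M \<alpha> p vs = 0)"

definition of_real_form :: "('m, 'n::finite, real) tensor \<Rightarrow> ('m, 'n, complex) tensor" where
  "of_real_form \<alpha> = (\<lambda>p vs. complex_of_real (\<alpha> p vs))"

definition imag_form :: "('m, 'n::finite, real) tensor \<Rightarrow> ('m, 'n, complex) tensor" where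
  "imag_form \<alpha> = (\<lambda>p vs. \<i> * complex_of_real (\<alpha> p vs))"

text \<open>For a bilinear form \<open>F\<close> and an endomorphism \<open>J\<close>, viewed as maps, the compositions \<open>FJ\<close>
  and \<open>J\<^sup>*FJ\<close> are \<open>F(JX, Y)\<close> and \<open>F(JX, JY)\<close>.\<close>

definition precomp ::
  "('m, 'n::finite, 'v::zero) tensor \<Rightarrow> ('m \<Rightarrow> real^'n \<Rightarrow> real^'n) \<Rightarrow> ('m, 'n, 'v) tensor" where
  "precomp F J p vs = (case vs of [] \<Rightarrow> 0 | v # ws \<Rightarrow> F p (J p v # ws))"

definition conjugate_by ::
  "('m \<Rightarrow> real^'n::finite \<Rightarrow> real^'n) \<Rightarrow> ('m, 'n, 'v) tensor \<Rightarrow> ('m, 'n, 'v) tensor" where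
  "conjugate_by J F p vs = F p (map (J p) vs)"

definition sym_part :: "('m, 'n::finite, real) tensor \<Rightarrow> ('m, 'n, real) tensor" where
  "sym_part F p vs = (F p vs + F p (rev vs)) / 2"

definition skew_part :: "('m, 'n::finite, real) tensor \<Rightarrow> ('m, 'n, real) tensor" where
  "skew_part F p vs = (F p vs - F p (rev vs)) / 2"

section \<open>Complexification\<close>

definition re_vec :: "complex^'n::finite \<Rightarrow> real^'n" where "re_vec z = (\<chi> i. Re (z $ i))"
definition im_vec :: "complex^'n::finite \<Rightarrow> real^'n" where "im_vec z = (\<chi> i. Im (z $ i))"
definition cplx_vec :: "real^'n::finite \<Rightarrow> complex^'n" where "cplx_vec v = (\<chi> i. complex_of_real (v $ i))"
definition cnj_vec :: "complex^'n::finite \<Rightarrow> complex^'n" where "cnj_vec z = (\<chi> i. cnj (z $ i))"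

definition cplx_map :: "(real^'n::finite \<Rightarrow> real^'n) \<Rightarrow> complex^'n \<Rightarrow> complex^'n" where
  "cplx_map f z = cplx_vec (f (re_vec z)) + \<i> *s cplx_vec (f (im_vec z))"

text \<open>The complex multilinear extension of a multilinear function to complex tangent vectors.\<close>

fun cplx_ext :: "((real^'n::finite) list \<Rightarrow> complex) \<Rightarrow> (complex^'n) list \<Rightarrow> complex" where
  "cplx_ext f [] = f []"
| "cplx_ext f (z # zs) = cplx_ext (\<lambda>vs. f (re_vec z # vs)) zs
     + \<i> * cplx_ext (\<lambda>vs. f (im_vec z # vs)) zs"

text \<open>Complex covectors are given by their components; the pairing is bilinear, not hermitian.\<close>

definition cpair :: "complex^'n::finite \<Rightarrow> complex^'n \<Rightarrow> complex" where
  "cpair \<xi> Z = (\<Sum>i\<in>UNIV. \<xi> $ i * Z $ i)"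

definition form_of_covec :: "complex^'n::finite \<Rightarrow> (real^'n) list \<Rightarrow> complex" where
  "form_of_covec \<xi> vs = (case vs of [v] \<Rightarrow> cpair \<xi> (cplx_vec v) | _ \<Rightarrow> 0)"

definition covec_of_form :: "((real^'n::finite) list \<Rightarrow> complex) \<Rightarrow> complex^'n" where
  "covec_of_form a = (\<chi> i. a [axis i 1])"

definition contract ::
  "complex^'n::finite \<Rightarrow> ((real^'n) list \<Rightarrow> complex) \<Rightarrow> (real^'n) list \<Rightarrow> complex" where
  "contract Z a vs = cplx_ext a (Z # map cplx_vec vs)"

section \<open>Complex structures and types of forms\<close>

text \<open>Integrability is the existence of holomorphic charts: around every point there is a chart,
  smoothly compatible with the atlas, that identifies the almost complex structure with that of a
  fixed complex vector space, namely \<open>real^'n\<close> with constant complex structure \<open>J\<^sub>0\<close>.\<close>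

definition complex_structure ::
  "('m::{t2_space,second_countable_topology}, 'n::finite) atlas \<Rightarrow>
     ('m \<Rightarrow> real^'n \<Rightarrow> real^'n) \<Rightarrow> bool" where
  "complex_structure M J \<longleftrightarrow>
     (\<forall>p. linear (J p) \<and> (\<forall>v. J p (J p v) = - v)) \<and>
     (\<forall>c\<in>M. \<forall>v. smooth_on (snd c ` fst c)
        (\<lambda>x. let q = chart_inv c x in to_chart M c q (J q (from_chart M c q v)))) \<and>
     (\<forall>p. \<exists>c J\<^sub>0. p \<in> fst c \<and> smooth_atlas (insert c M) \<and>
        linear J\<^sub>0 \<and> (\<forall>v. J\<^sub>0 (J\<^sub>0 v) = - v) \<and>
        (\<forall>q\<in>fst c. \<forall>v. to_chart M c q (J q v) = J\<^sub>0 (to_chart M c q v)))"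

definition T10 :: "(real^'n::finite \<Rightarrow> real^'n) \<Rightarrow> (complex^'n) set" where
  "T10 J = {Z. cplx_map J Z = \<i> *s Z}"

definition T01 :: "(real^'n::finite \<Rightarrow> real^'n) \<Rightarrow> (complex^'n) set" where
  "T01 J = {Z. cplx_map J Z = - (\<i> *s Z)}"

definition coT10 :: "(real^'n::finite \<Rightarrow> real^'n) \<Rightarrow> (complex^'n) set" where
  "coT10 J = {\<xi>. \<forall>Z\<in>T01 J. cpair \<xi> Z = 0}"

definition proj10 :: "(real^'n::finite \<Rightarrow> real^'n) \<Rightarrow> complex^'n \<Rightarrow> complex^'n" where
  "proj10 J Z = (1/2) *s (Z - \<i> *s cplx_map J Z)"

definition proj01 :: "(real^'n::finite \<Rightarrow> real^'n) \<Rightarrow> complex^'n \<Rightarrow> complex^'n" where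
  "proj01 J Z = (1/2) *s (Z + \<i> *s cplx_map J Z)"

text \<open>The component of type \<open>(a, b)\<close> of a form of degree \<open>a + b\<close>.\<close>

definition type_part ::
  "('m \<Rightarrow> real^'n::finite \<Rightarrow> real^'n) \<Rightarrow> nat \<Rightarrow> nat \<Rightarrow> ('m, 'n, complex) tensor \<Rightarrow>
     ('m, 'n, complex) tensor" where
  "type_part J a b \<alpha> p vs =
     (if length vs = a + b
      then \<Sum>S | S \<subseteq> {..<a + b} \<and> card S = a.
             cplx_ext (\<alpha> p)
               (map (\<lambda>i. (if i \<in> S then proj10 (J p) else proj01 (J p)) (cplx_vec (vs ! i)))
                  [0..<a + b])
      else 0)"

definition form_of_type ::
  "('m, 'n::finite) atlas \<Rightarrow> ('m \<Rightarrow> real^'n \<Rightarrow> real^'n) \<Rightarrow> nat \<Rightarrow> nat \<Rightarrow>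
     ('m, 'n, complex) tensor \<Rightarrow> bool" where
  "form_of_type M J a b \<alpha> \<longleftrightarrow> smooth_form M (a + b) \<alpha> \<and> type_part J a b \<alpha> = \<alpha>"

text \<open>On \<open>k\<close>-forms \<open>\<partial>\<close> is the sum over \<open>a + b = k\<close> of the \<open>(a + 1, b)\<close>-component of \<open>d\<close> applied
  to the \<open>(a, b)\<close>-component; in the definitions \<open>k + 1\<close> is the length of \<open>vs\<close>.\<close>

definition del ::
  "('m, 'n::finite) atlas \<Rightarrow> ('m \<Rightarrow> real^'n \<Rightarrow> real^'n) \<Rightarrow> ('m, 'n, complex) tensor \<Rightarrow>
     ('m, 'n, complex) tensor" where
  "del M J \<alpha> p vs = (\<Sum>a<length vs. let b = length vs - 1 - a in
     type_part J (Suc a) b (ext_d M (type_part J a b \<alpha>)) p vs)"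

definition delbar ::
  "('m, 'n::finite) atlas \<Rightarrow> ('m \<Rightarrow> real^'n \<Rightarrow> real^'n) \<Rightarrow> ('m, 'n, complex) tensor \<Rightarrow>
     ('m, 'n, complex) tensor" where
  "delbar M J \<alpha> p vs = (\<Sum>a<length vs. let b = length vs - 1 - a in
     type_part J a (Suc b) (ext_d M (type_part J a b \<alpha>)) p vs)"

definition d_c ::
  "('m, 'n::finite) atlas \<Rightarrow> ('m \<Rightarrow> real^'n \<Rightarrow> real^'n) \<Rightarrow> ('m, 'n, complex) tensor \<Rightarrow>
     ('m, 'n, complex) tensor" where
  "d_c M J \<alpha> p vs = \<i> * (delbar M J \<alpha> p vs - del M J \<alpha> p vs)"

section \<open>The generalized tangent bundle\<close>

text \<open>A fibre of \<open>T\<^sub>\<complex>M \<oplus> T\<^sup>*\<^sub>\<complex>M\<close>, with complex scalar multiplication \<open>gscale\<close>.\<close>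

type_synonym 'n gvector = "(complex^'n) \<times> (complex^'n)"

definition gscale :: "complex \<Rightarrow> 'n::finite gvector \<Rightarrow> 'n gvector" where
  "gscale a u = (a *s fst u, a *s snd u)"

global_interpretation gvec: vector_space "gscale :: complex \<Rightarrow> 'n::finite gvector \<Rightarrow> 'n gvector"
  by unfold_locales (auto simp: gscale_def vec_eq_iff algebra_simps)

definition gpair :: "'n::finite gvector \<Rightarrow> 'n gvector \<Rightarrow> complex" where
  "gpair u v = cpair (snd v) (fst u) + cpair (snd u) (fst v)"

definition gconj :: "'n::finite gvector \<Rightarrow> 'n gvector" where
  "gconj u = (cnj_vec (fst u), cnj_vec (snd u))"

definition exp_B :: "((real^'n::finite) list \<Rightarrow> complex) \<Rightarrow> 'n gvector \<Rightarrow> 'n gvector" where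
  "exp_B B u = (fst u, snd u + covec_of_form (contract (fst u) B))"

definition coord_field ::
  "('m, 'n::finite) atlas \<Rightarrow> ('m, 'n) chart \<Rightarrow> ('m \<Rightarrow> complex^'n) \<Rightarrow> real^'n \<Rightarrow> complex^'n" where
  "coord_field M c X x = (let q = chart_inv c x in cplx_map (to_chart M c q) (X q))"

definition smooth_section ::
  "('m, 'n::finite) atlas \<Rightarrow> 'm set \<Rightarrow> ('m \<Rightarrow> 'n gvector) \<Rightarrow> bool" where
  "smooth_section M U s \<longleftrightarrow> (\<forall>c\<in>M.
     smooth_on (snd c ` (U \<inter> fst c)) (coord_field M c (\<lambda>p. fst (s p))) \<and>
     (\<forall>v. smooth_on (snd c ` (U \<inter> fst c))
        (\<lambda>x. coord_tensor M c (\<lambda>p. form_of_covec (snd (s p))) x [v])))"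

definition cplx_deriv :: "(real^'n::finite \<Rightarrow> complex^'n) \<Rightarrow> real^'n \<Rightarrow> complex^'n \<Rightarrow> complex^'n" where
  "cplx_deriv f x Z =
     frechet_derivative f (at x) (re_vec Z) + \<i> *s frechet_derivative f (at x) (im_vec Z)"

definition lie_bracket ::
  "('m, 'n::finite) atlas \<Rightarrow> ('m \<Rightarrow> complex^'n) \<Rightarrow> ('m \<Rightarrow> complex^'n) \<Rightarrow> 'm \<Rightarrow> complex^'n" where
  "lie_bracket M X Y p = (let c = chart_at M p in
     cplx_deriv (coord_field M c Y) (snd c p) (X p) - cplx_deriv (coord_field M c X) (snd c p) (Y p))"

definition lie_derivative ::
  "('m, 'n::finite) atlas \<Rightarrow> ('m \<Rightarrow> complex^'n) \<Rightarrow> ('m, 'n, complex) tensor \<Rightarrow>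
     ('m, 'n, complex) tensor" where
  "lie_derivative M X \<alpha> p vs =
     ext_d M (\<lambda>q. contract (X q) (\<alpha> q)) p vs + contract (X p) (ext_d M \<alpha> p) vs"

text \<open>The bracket at \<open>p\<close> depends only on the germs of the sections at \<open>p\<close>, so it also makes sense
  for sections over open subsets; their values elsewhere are irrelevant.\<close>

definition courant_bracket ::
  "('m, 'n::finite) atlas \<Rightarrow> ('m, 'n, complex) tensor \<Rightarrow>
     ('m \<Rightarrow> 'n gvector) \<Rightarrow> ('m \<Rightarrow> 'n gvector) \<Rightarrow> 'm \<Rightarrow> 'n gvector" where
  "courant_bracket M H s t p =
     (let X = (\<lambda>q. fst (s q)); \<alpha> = (\<lambda>q. form_of_covec (snd (s q)));
          Y = (\<lambda>q. fst (t q)); \<beta> = (\<lambda>q. form_of_covec (snd (t q)))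
      in (lie_bracket M X Y p,
          covec_of_form (\<lambda>vs. lie_derivative M X \<beta> p vs - contract (Y p) (ext_d M \<alpha> p) vs
            + contract (X p) (contract (Y p) (H p)) vs)))"

section \<open>Holomorphic Courant algebroids, Dirac structures and Manin triples\<close>

definition gT10 :: "(real^'n::finite \<Rightarrow> real^'n) \<Rightarrow> 'n gvector set" where
  "gT10 J = T10 J \<times> coT10 J"

definition gproj10 :: "(real^'n::finite \<Rightarrow> real^'n) \<Rightarrow> 'n gvector \<Rightarrow> 'n gvector" where
  "gproj10 J u = (proj10 J (fst u), \<chi> i. cpair (snd u) (proj10 J (axis i 1)))"

text \<open>The holomorphic exact Courant algebroid defined by \<open>H\<close> on the bundle with fibres
  \<open>gT10 (J p)\<close> is represented by the form \<open>H\<close>.\<close>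

definition courant_form ::
  "('m, 'n::finite) atlas \<Rightarrow> ('m \<Rightarrow> real^'n \<Rightarrow> real^'n) \<Rightarrow> ('m, 'n, complex) tensor \<Rightarrow> bool" where
  "courant_form M J H \<longleftrightarrow>
     (\<exists>H21 H30. form_of_type M J 2 1 H21 \<and> form_of_type M J 3 0 H30 \<and>
        H = (\<lambda>p vs. H21 p vs + H30 p vs)) \<and>
     closed_form M H"

definition holomorphic_section ::
  "('m::topological_space, 'n::finite) atlas \<Rightarrow> ('m \<Rightarrow> real^'n \<Rightarrow> real^'n) \<Rightarrow>
     ('m, 'n, complex) tensor \<Rightarrow> 'm set \<Rightarrow> ('m \<Rightarrow> 'n gvector) \<Rightarrow> bool" where
  "holomorphic_section M J H U s \<longleftrightarrow>
     smooth_section M U s \<and> (\<forall>p\<in>U. s p \<in> gT10 (J p)) \<and>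
     (\<forall>V X. open V \<and> V \<subseteq> U \<and> smooth_section M V (\<lambda>p. (X p, 0)) \<and> (\<forall>p\<in>V. X p \<in> T01 (J p)) \<longrightarrow>
        (\<forall>p\<in>V. gproj10 (J p) (courant_bracket M H (\<lambda>q. (X q, 0)) s p) = 0))"

text \<open>A subbundle is given by its fibres, and is holomorphic if it has local frames of
  holomorphic sections.\<close>

definition holomorphic_subbundle ::
  "('m::topological_space, 'n::finite) atlas \<Rightarrow> ('m \<Rightarrow> real^'n \<Rightarrow> real^'n) \<Rightarrow>
     ('m, 'n, complex) tensor \<Rightarrow> ('m \<Rightarrow> 'n gvector set) \<Rightarrow> bool" where
  "holomorphic_subbundle M J H L \<longleftrightarrow>
     (\<forall>p. \<exists>U ss. open U \<and> p \<in> U \<and> (\<forall>s\<in>set ss. holomorphic_section M J H U s) \<and>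
        (\<forall>q\<in>U. distinct (map (\<lambda>s. s q) ss) \<and> gvec.independent (set (map (\<lambda>s. s q) ss)) \<and>
           L q = gvec.span (set (map (\<lambda>s. s q) ss))))"

definition isotropic :: "'n::finite gvector set \<Rightarrow> bool" where
  "isotropic L \<longleftrightarrow> (\<forall>u\<in>L. \<forall>v\<in>L. gpair u v = 0)"

definition maximal_isotropic :: "'n::finite gvector set \<Rightarrow> 'n gvector set \<Rightarrow> bool" where
  "maximal_isotropic E L \<longleftrightarrow> gvec.subspace L \<and> L \<subseteq> E \<and> isotropic L \<and>
     (\<forall>L'. gvec.subspace L' \<and> L' \<subseteq> E \<and> isotropic L' \<and> L \<subseteq> L' \<longrightarrow> L' = L)"

definition holomorphic_Dirac ::
  "('m::topological_space, 'n::finite) atlas \<Rightarrow> ('m \<Rightarrow> real^'n \<Rightarrow> real^'n) \<Rightarrow>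
     ('m, 'n, complex) tensor \<Rightarrow> ('m \<Rightarrow> 'n gvector set) \<Rightarrow> bool" where
  "holomorphic_Dirac M J H L \<longleftrightarrow>
     holomorphic_subbundle M J H L \<and>
     (\<forall>p. maximal_isotropic (gT10 (J p)) (L p)) \<and>
     (\<forall>U s t. open U \<and> holomorphic_section M J H U s \<and> holomorphic_section M J H U t \<and>
        (\<forall>p\<in>U. s p \<in> L p \<and> t p \<in> L p) \<longrightarrow>
        (\<forall>p\<in>U. gproj10 (J p) (courant_bracket M H s t p) \<in> L p))"

definition holomorphic_Manin_triple ::
  "('m::topological_space, 'n::finite) atlas \<Rightarrow> ('m \<Rightarrow> real^'n \<Rightarrow> real^'n) \<Rightarrow>
     ('m, 'n, complex) tensor \<Rightarrow> ('m \<Rightarrow> 'n gvector set) \<Rightarrow> ('m \<Rightarrow> 'n gvector set) \<Rightarrow> bool" where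
  "holomorphic_Manin_triple M J H A B \<longleftrightarrow>
     courant_form M J H \<and> holomorphic_Dirac M J H A \<and> holomorphic_Dirac M J H B \<and>
     (\<forall>p. A p \<inter> B p = {0} \<and> {a + b | a b. a \<in> A p \<and> b \<in> B p} = gT10 (J p))"

definition matched_pair ::
  "('m \<Rightarrow> real^'n::finite \<Rightarrow> real^'n) \<Rightarrow> ('m \<Rightarrow> 'n gvector set) \<Rightarrow> 'm \<Rightarrow> 'n gvector set" where
  "matched_pair J A p = {a + (Z, 0) | a Z. a \<in> A p \<and> Z \<in> T01 (J p)}"

section \<open>Generalized Kaehler structures\<close>

definition positive_definite :: "('m, 'n::finite, real) tensor \<Rightarrow> bool" where
  "positive_definite g \<longleftrightarrow> (\<forall>p v. v \<noteq> 0 \<longrightarrow> g p [v, v] > 0)"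

definition Riemannian_metric :: "('m, 'n::finite) atlas \<Rightarrow> ('m, 'n, real) tensor \<Rightarrow> bool" where
  "Riemannian_metric M g \<longleftrightarrow>
     smooth_tensor M 2 g \<and> (\<forall>p v w. g p [v, w] = g p [w, v]) \<and> positive_definite g"

definition generalized_Kaehler ::
  "('m::{t2_space,second_countable_topology}, 'n::finite) atlas \<Rightarrow> ('m, 'n, real) tensor \<Rightarrow>
     ('m \<Rightarrow> real^'n \<Rightarrow> real^'n) \<Rightarrow> ('m \<Rightarrow> real^'n \<Rightarrow> real^'n) \<Rightarrow> ('m, 'n, real) tensor \<Rightarrow> bool" where
  "generalized_Kaehler M g Jp Jm H \<longleftrightarrow>
     Riemannian_metric M g \<and> complex_structure M Jp \<and> complex_structure M Jm \<and>
     (\<forall>p v w. g p [Jp p v, Jp p w] = g p [v, w] \<and> g p [Jm p v, Jm p w] = g p [v, w]) \<and>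
     smooth_form M 3 H \<and> closed_form M H \<and>
     d_c M Jp (of_real_form (precomp g Jp)) = of_real_form H \<and>
     (\<lambda>p vs. - d_c M Jm (of_real_form (precomp g Jm)) p vs) = of_real_form H"

end

theory Submission
  imports Defs
begin

text \<open>At a point, \<open>T\<^sub>0\<^sub>1\<close> of \<open>I\<^sub>+\<close> lies in both matched pairs over \<open>X\<^sub>+\<close>, so the two matching conditions
  force \<open>F\<^sub>1(I\<^sub>+X, Y) = - F\<^sub>1(X, I\<^sub>-Y)\<close> and \<open>F\<^sub>2(I\<^sub>+X, Y) = F\<^sub>2(X, I\<^sub>-Y)\<close>. Hence \<open>F\<^sub>+I\<^sub>+\<close> is the transpose
  of \<open>F\<^sub>-I\<^sub>-\<close>, which gives the coincidences of \<open>g\<close> and \<open>b\<close>. The equations for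
  \<open>d(\<i>F\<^sub>1)\<close> and \<open>d(\<i>F\<^sub>2)\<close> say that \<open>H\<^sub>+\<close> and \<open>H\<^sub>-\<close> have the same real part and imaginary parts
  \<open>- dF\<^sub>+\<close> and \<open>dF\<^sub>-\<close>. On forms of type (2,1) + (3,0), \<open>J\<close> acting as a derivation plus the pullback
  by \<open>J\<close> is multiplication by \<open>2\<i>\<close>, so \<open>Re H\<^sub>\<plusminus>\<close> is determined by \<open>dF\<^sub>\<plusminus>\<close>; the operator \<open>d\<^sup>c\<close> on
  (1,1)-forms is expressed by the same two operations. The equation for \<open>d\<^sup>c\<omega>\<^sub>\<plusminus>\<close> then becomes an
  identity between real 3-forms, verified in a chart in which \<open>J\<close> is constant.\<close>

section \<open>Calculus of smooth maps\<close>

text \<open>A holomorphic chart is compatible with the atlas but need not belong to it, and the two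
  complex structures in general have no common holomorphic chart. Tensor calculus is therefore
  developed for every \<open>c\<close> with \<open>smooth_atlas (insert c M)\<close>, and the
  differential part treats one structure \<open>J\<close> and one 2-form \<open>F\<close> at a time;
  the two signs meet only in pointwise relations between forms. The constants arise as follows. On
  3-forms let D be the derivation action of \<open>J\<close> and N the pullback by \<open>J\<close>.
  Projecting to types turns d^c of a (1,1)-form \<omega> into -(D + 3N) d\<omega> / 4. Here \<omega>
  = (F + C)/2 with C the pullback of F, and b = -K/2 with K(v, w) = F(Jv, w) + F(v, Jw). If dF = -s
  Im P and (D + N) P = 2 i P, then (D + N) dF = -2 s Re P, so d^c \<omega> = s Re P - db amounts to
  (D + 3N) dC + 4 dK = (3D + N) dF. Since D + N is a scalar on P, its components of type (2,1) and
  (3,0) need not be followed separately.\<close>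

lemma frechet_derivative_eqI: "(f has_derivative f') (at x) \<Longrightarrow> frechet_derivative f (at x) = f'"
  by (metis frechet_derivative_at)

lemma differentiable_cong_open:
  assumes "open S" "x \<in> S" "\<And>y. y \<in> S \<Longrightarrow> f y = g y" "f differentiable at x"
  shows "g differentiable at x"
  using assms by (meson differentiable_def has_derivative_transform_within_open)

text \<open>Agreement on an open set passes to the derivatives at its points. This allows formulas
  that hold only on the domain of a chart to be differentiated.\<close>

lemma Ck_on_cong:
  assumes "open S" "\<And>x. x \<in> S \<Longrightarrow> f x = g x" "Ck_on k S f"
  shows "Ck_on k S g"
  using assms(2,3)
proof (induction k arbitrary: f g)
  case 0
  then show ?case by (simp cong: continuous_on_cong)
next
  case (Suc k)
  have "Ck_on k S (\<lambda>x. frechet_derivative g (at x) v)" for v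
  proof (rule Suc.IH)
    show "Ck_on k S (\<lambda>x. frechet_derivative f (at x) v)" using Suc.prems by simp
    show "frechet_derivative f (at x) v = frechet_derivative g (at x) v" if "x \<in> S" for x
      using frechet_derivative_transform_within_open[of f x S g] Suc.prems that assms(1) by auto
  qed
  moreover have "\<forall>x\<in>S. g differentiable at x"
    using Suc.prems differentiable_cong_open[OF assms(1), of _ f g] by auto
  ultimately show ?case by simp
qed

lemma Ck_on_Suc_D: "Ck_on (Suc k) S f \<Longrightarrow> Ck_on k S f"
proof (induction k arbitrary: f)
  case 0
  then show ?case
    by (simp add: differentiable_imp_continuous_on differentiable_at_imp_differentiable_on)
next
  case (Suc k)
  then show ?case by (metis Ck_on.simps(2))
qed

lemma Ck_on_const: "Ck_on k S (\<lambda>x. c)"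
  by (induction k arbitrary: c) auto

lemma Ck_on_add:
  assumes "open S" "Ck_on k S f" "Ck_on k S g"
  shows "Ck_on k S (\<lambda>x. f x + g x)"
  using assms(2,3)
proof (induction k arbitrary: f g)
  case 0
  then show ?case by (simp add: continuous_on_add)
next
  case (Suc k)
  have "Ck_on k S (\<lambda>x. frechet_derivative (\<lambda>x. f x + g x) (at x) v)" for v
  proof (rule Ck_on_cong[OF assms(1)])
    show "Ck_on k S (\<lambda>x. frechet_derivative f (at x) v + frechet_derivative g (at x) v)"
      using Suc by simp
    show "frechet_derivative f (at x) v + frechet_derivative g (at x) v
        = frechet_derivative (\<lambda>x. f x + g x) (at x) v" if "x \<in> S" for x
      using Suc.prems that
      by (subst frechet_derivative_eqI[OF has_derivative_add])
         (auto simp: frechet_derivative_works[symmetric])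
  qed
  then show ?case using Suc.prems by auto
qed

lemma Ck_on_bounded_linear:
  assumes "open S" "bounded_linear h" "Ck_on k S f"
  shows "Ck_on k S (\<lambda>x. h (f x))"
  using assms(3)
proof (induction k arbitrary: f)
  case 0
  then show ?case
    using bounded_linear.continuous_on[OF assms(2)] by auto
next
  case (Suc k)
  have d: "((\<lambda>x. h (f x)) has_derivative (\<lambda>v. h (frechet_derivative f (at x) v))) (at x)" if "x \<in> S" for x
    using Suc.prems that by (intro bounded_linear.has_derivative[OF assms(2)]) (auto simp: frechet_derivative_works[symmetric])
  have "Ck_on k S (\<lambda>x. frechet_derivative (\<lambda>x. h (f x)) (at x) v)" for v
  proof (rule Ck_on_cong[OF assms(1)])
    show "Ck_on k S (\<lambda>x. h (frechet_derivative f (at x) v))" using Suc by simp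
    show "h (frechet_derivative f (at x) v) = frechet_derivative (\<lambda>x. h (f x)) (at x) v"
      if "x \<in> S" for x
      using frechet_derivative_eqI[OF d[OF that]] by simp
  qed
  moreover have "\<forall>x\<in>S. (\<lambda>x. h (f x)) differentiable at x"
    using d differentiableI by blast
  ultimately show ?case by simp
qed

lemma Ck_on_scaleR:
  assumes "open S" "Ck_on k S f" "Ck_on k S g"
  shows "Ck_on k S (\<lambda>x. f x *\<^sub>R g x)"
  using assms(2,3)
proof (induction k arbitrary: f g)
  case 0
  then show ?case by (simp add: continuous_on_scaleR)
next
  case (Suc k)
  have d: "((\<lambda>x. f x *\<^sub>R g x) has_derivative
      (\<lambda>v. f x *\<^sub>R frechet_derivative g (at x) v + frechet_derivative f (at x) v *\<^sub>R g x)) (at x)"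
    if "x \<in> S" for x
    using Suc.prems that by (intro has_derivative_scaleR) (auto simp: frechet_derivative_works[symmetric])
  have "Ck_on k S (\<lambda>x. frechet_derivative (\<lambda>x. f x *\<^sub>R g x) (at x) v)" for v
  proof (rule Ck_on_cong[OF assms(1)])
    \<comment> \<open>The product rule mixes derivatives with undifferentiated factors, so the
      latter are lowered from \<open>Suc k\<close> to \<open>k\<close> before the induction
      hypothesis applies.\<close>
    show "Ck_on k S (\<lambda>x. f x *\<^sub>R frechet_derivative g (at x) v + frechet_derivative f (at x) v *\<^sub>R g x)"
      using Suc.prems Ck_on_Suc_D[OF Suc.prems(1)] Ck_on_Suc_D[OF Suc.prems(2)]
      by (intro Ck_on_add assms Suc.IH) auto
    show "f x *\<^sub>R frechet_derivative g (at x) v + frechet_derivative f (at x) v *\<^sub>R g x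
        = frechet_derivative (\<lambda>x. f x *\<^sub>R g x) (at x) v"
      if "x \<in> S" for x
      using frechet_derivative_eqI[OF d[OF that]] by simp
  qed
  moreover have "\<forall>x\<in>S. (\<lambda>x. f x *\<^sub>R g x) differentiable at x"
    using d differentiableI by blast
  ultimately show ?case by simp
qed

lemma smooth_on_cong:
  "open S \<Longrightarrow> (\<And>x. x \<in> S \<Longrightarrow> f x = g x) \<Longrightarrow> smooth_on S f \<Longrightarrow> smooth_on S g"
  unfolding smooth_on_def using Ck_on_cong by metis

lemma smooth_on_const: "smooth_on S (\<lambda>x. c)"
  by (simp add: smooth_on_def Ck_on_const)

lemma smooth_on_add: "open S \<Longrightarrow> smooth_on S f \<Longrightarrow> smooth_on S g \<Longrightarrow> smooth_on S (\<lambda>x. f x + g x)"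
  by (simp add: smooth_on_def Ck_on_add)

lemma smooth_on_bounded_linear:
  "open S \<Longrightarrow> bounded_linear h \<Longrightarrow> smooth_on S f \<Longrightarrow> smooth_on S (\<lambda>x. h (f x))"
  by (simp add: smooth_on_def Ck_on_bounded_linear)

lemma smooth_on_scaleR:
  "open S \<Longrightarrow> smooth_on S f \<Longrightarrow> smooth_on S g \<Longrightarrow> smooth_on S (\<lambda>x. f x *\<^sub>R g x)"
  by (simp add: smooth_on_def Ck_on_scaleR)

lemma smooth_on_sum:
  assumes "open S" "\<And>i. i \<in> A \<Longrightarrow> smooth_on S (f i)"
  shows "smooth_on S (\<lambda>x. \<Sum>i\<in>A. f i x)"
  using assms(2)
  by (induction A rule: infinite_finite_induct) (auto intro: smooth_on_const smooth_on_add assms(1))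

lemma smooth_on_frechet_derivative: "smooth_on S f \<Longrightarrow> smooth_on S (\<lambda>x. frechet_derivative f (at x) v)"
  unfolding smooth_on_def by (metis Ck_on.simps(2))

lemma smooth_on_differentiable: "smooth_on S f \<Longrightarrow> x \<in> S \<Longrightarrow> f differentiable (at x)"
  unfolding smooth_on_def by (metis Ck_on.simps(2))

lemma smooth_on_has_derivative:
  "smooth_on S f \<Longrightarrow> x \<in> S \<Longrightarrow> (f has_derivative frechet_derivative f (at x)) (at x)"
  using smooth_on_differentiable frechet_derivative_works by blast

lemma smooth_on_continuous_on: "smooth_on S f \<Longrightarrow> continuous_on S f"
  unfolding smooth_on_def by (metis Ck_on.simps(1))

subsection \<open>Symmetry of second derivatives\<close>

text \<open>The second difference is the increment over [0, h] of \<open>q\<close>, itself a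
  difference in direction \<open>v\<close>. The mean value theorem is applied once along
  \<open>u\<close> and once along \<open>v\<close>. The left-hand side does not change when
  \<open>u\<close> and \<open>v\<close> are exchanged, which is the source of symmetry.\<close>

lemma second_difference_mvt:
  fixes f :: "'a::real_normed_vector \<Rightarrow> real"
  assumes S: "\<And>s t. 0 \<le> s \<Longrightarrow> s \<le> h \<Longrightarrow> 0 \<le> t \<Longrightarrow> t \<le> h \<Longrightarrow> x + s *\<^sub>R u + t *\<^sub>R v \<in> S"
    and f: "smooth_on S f" and h: "h > 0"
  shows "\<exists>s t. 0 < s \<and> s < h \<and> 0 < t \<and> t < h \<and>
     f (x + h *\<^sub>R u + h *\<^sub>R v) - f (x + h *\<^sub>R u) - f (x + h *\<^sub>R v) + f x =
     h * h * frechet_derivative (\<lambda>y. frechet_derivative f (at y) u) (at (x + s *\<^sub>R u + t *\<^sub>R v)) v"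
proof -
  let ?D = "\<lambda>y. frechet_derivative f (at y) u"
  have line: "((\<lambda>s. g (a + s *\<^sub>R w)) has_real_derivative frechet_derivative g (at (a + s *\<^sub>R w)) w) (at s)"
    if "smooth_on S g" "a + s *\<^sub>R w \<in> S" for g :: "'a \<Rightarrow> real" and a w s
  proof -
    have "((\<lambda>s. a + s *\<^sub>R w) has_derivative (\<lambda>r. r *\<^sub>R w)) (at s)"
      by (auto intro!: derivative_eq_intros)
    from has_derivative_compose[OF this smooth_on_has_derivative[OF that]]
    have "((\<lambda>s. g (a + s *\<^sub>R w)) has_derivative (\<lambda>r. frechet_derivative g (at (a + s *\<^sub>R w)) (r *\<^sub>R w))) (at s)" .
    moreover have "linear (frechet_derivative g (at (a + s *\<^sub>R w)))"
      using linear_frechet_derivative smooth_on_differentiable that by blast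
    ultimately show ?thesis
      by (simp add: linear_scale has_field_derivative_def mult_commute_abs)
  qed
  define q where "q s = f (x + h *\<^sub>R v + s *\<^sub>R u) - f (x + s *\<^sub>R u)" for s
  have dq: "(q has_real_derivative (?D (x + h *\<^sub>R v + s *\<^sub>R u) - ?D (x + s *\<^sub>R u))) (at s)"
    if "0 \<le> s" "s \<le> h" for s
    unfolding q_def using that h S[of s h] S[of s 0]
    by (intro DERIV_diff line f) (auto simp: algebra_simps)
  obtain s where s: "0 < s" "s < h" "q h - q 0 = (h - 0) * (?D (x + h *\<^sub>R v + s *\<^sub>R u) - ?D (x + s *\<^sub>R u))"
    using MVT2[of 0 h q "\<lambda>s. ?D (x + h *\<^sub>R v + s *\<^sub>R u) - ?D (x + s *\<^sub>R u)"] dq h by auto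
  have dt: "((\<lambda>t. ?D (x + s *\<^sub>R u + t *\<^sub>R v)) has_real_derivative
      frechet_derivative ?D (at (x + s *\<^sub>R u + t *\<^sub>R v)) v) (at t)"
    if "0 \<le> t" "t \<le> h" for t
    using that s S[of s t] by (intro line smooth_on_frechet_derivative[OF f]) auto
  obtain t where t: "0 < t" "t < h"
    "?D (x + s *\<^sub>R u + h *\<^sub>R v) - ?D (x + s *\<^sub>R u + 0 *\<^sub>R v)
      = (h - 0) * frechet_derivative ?D (at (x + s *\<^sub>R u + t *\<^sub>R v)) v"
    using MVT2[OF h dt] by blast
  show ?thesis
    by (rule exI[of _ s], rule exI[of _ t]) (use s t in \<open>auto simp: q_def algebra_simps\<close>)
qed

text \<open>One and the same second difference equals \<open>h * h\<close> times either mixed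
  derivative, each taken at some point of a small parallelogram at \<open>x\<close>; continuity
  carries the equality to \<open>x\<close> itself.\<close>

lemma second_derivative_symmetric_real:
  fixes f :: "'a::real_normed_vector \<Rightarrow> real"
  assumes "open S" "x \<in> S" and f: "smooth_on S f"
  shows "frechet_derivative (\<lambda>y. frechet_derivative f (at y) u) (at x) v =
    frechet_derivative (\<lambda>y. frechet_derivative f (at y) v) (at x) u" (is "?A x = ?B x")
proof -
  have cont: "isCont ?A x" "isCont ?B x"
    using assms smooth_on_continuous_on smooth_on_frechet_derivative continuous_on_eq_continuous_at
    by metis+
  have "\<bar>?A x - ?B x\<bar> < e" if e: "e > 0" for e
  proof -
    obtain d where d: "d > 0" "\<And>y. dist y x < d \<Longrightarrow> y \<in> S \<and> dist (?A y) (?A x) < e/2 \<and> dist (?B y) (?B x) < e/2"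
    proof -
      obtain d1 where "d1 > 0" "\<And>y. dist y x < d1 \<Longrightarrow> y \<in> S"
        using assms by (meson open_dist)
      moreover obtain d2 where "d2 > 0" "\<And>y. dist y x < d2 \<Longrightarrow> dist (?A y) (?A x) < e/2"
        using cont(1)[unfolded continuous_at_eps_delta, rule_format, of "e/2"] e by auto
      moreover obtain d3 where "d3 > 0" "\<And>y. dist y x < d3 \<Longrightarrow> dist (?B y) (?B x) < e/2"
        using cont(2)[unfolded continuous_at_eps_delta, rule_format, of "e/2"] e by auto
      ultimately show thesis by (intro that[of "min d1 (min d2 d3)"]) auto
    qed
    \<comment> \<open>The summand 1 keeps the denominator positive even for
      \<open>u = v = 0\<close>; the parallelogram with sides \<open>h u\<close> and
      \<open>h v\<close> then stays within distance \<open>d / 2\<close> of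
      \<open>x\<close>.\<close>
    define h where "h = d / (2 * (norm u + norm v + 1))"
    have n: "norm u + norm v + 1 > 0"
      by (simp add: add_nonneg_pos)
    have h: "h > 0" using d(1) n by (simp add: h_def)
    have near: "dist (x + s *\<^sub>R u + t *\<^sub>R v) x < d" "dist (x + s *\<^sub>R v + t *\<^sub>R u) x < d"
      if "0 \<le> s" "s \<le> h" "0 \<le> t" "t \<le> h" for s t
    proof -
      have "norm (s *\<^sub>R a + t *\<^sub>R b) < d" if "norm a + norm b = norm u + norm v" for a b :: 'a
      proof -
        have "norm (s *\<^sub>R a + t *\<^sub>R b) \<le> s * norm a + t * norm b"
          using norm_triangle_ineq[of "s *\<^sub>R a" "t *\<^sub>R b"] \<open>0 \<le> s\<close> \<open>0 \<le> t\<close> by simp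
        also have "\<dots> \<le> h * norm a + h * norm b"
          using \<open>s \<le> h\<close> \<open>t \<le> h\<close> by (intro add_mono mult_right_mono) auto
        also have "\<dots> < h * (norm u + norm v + 1)" using h that by (simp flip: distrib_left)
        also have "\<dots> = d / 2" using n unfolding h_def by (simp add: divide_simps)
        finally show ?thesis using d(1) by simp
      qed
      from this[of u v] this[of v u] show "dist (x + s *\<^sub>R u + t *\<^sub>R v) x < d" "dist (x + s *\<^sub>R v + t *\<^sub>R u) x < d"
        by (auto simp: dist_norm add.assoc)
    qed
    obtain s t where A: "0 < s" "s < h" "0 < t" "t < h"
      "f (x + h *\<^sub>R u + h *\<^sub>R v) - f (x + h *\<^sub>R u) - f (x + h *\<^sub>R v) + f x = h * h * ?A (x + s *\<^sub>R u + t *\<^sub>R v)"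
      using second_difference_mvt[where S = S and f = f, OF _ f h, of x u v] near d by blast
    obtain s' t' where B: "0 < s'" "s' < h" "0 < t'" "t' < h"
      "f (x + h *\<^sub>R v + h *\<^sub>R u) - f (x + h *\<^sub>R v) - f (x + h *\<^sub>R u) + f x = h * h * ?B (x + s' *\<^sub>R v + t' *\<^sub>R u)"
      using second_difference_mvt[where S = S and f = f, OF _ f h, of x v u] near d by blast
    have "h * h * ?A (x + s *\<^sub>R u + t *\<^sub>R v) = h * h * ?B (x + s' *\<^sub>R v + t' *\<^sub>R u)"
      unfolding A(5)[symmetric] B(5)[symmetric] by (simp add: algebra_simps)
    then have "?A (x + s *\<^sub>R u + t *\<^sub>R v) = ?B (x + s' *\<^sub>R v + t' *\<^sub>R u)" using h by simp
    moreover have "dist (?A (x + s *\<^sub>R u + t *\<^sub>R v)) (?A x) < e/2" "dist (?B (x + s' *\<^sub>R v + t' *\<^sub>R u)) (?B x) < e/2"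
      using A B near d(2) by (meson less_imp_le)+
    ultimately show ?thesis unfolding dist_real_def by linarith
  qed
  then show ?thesis
    by (metis abs_le_zero_iff eq_iff_diff_eq_0 less_irrefl not_le)
qed

text \<open>The mean value theorem fails for vector-valued maps, so the real case is applied to the
  inner products with basis vectors.\<close>

lemma second_derivative_symmetric:
  fixes f :: "'a::real_normed_vector \<Rightarrow> 'b::euclidean_space"
  assumes "open S" "x \<in> S" and f: "smooth_on S f"
  shows "frechet_derivative (\<lambda>y. frechet_derivative f (at y) u) (at x) v =
    frechet_derivative (\<lambda>y. frechet_derivative f (at y) v) (at x) u"
proof (rule euclidean_eqI)
  fix b :: 'b
  have bl: "bounded_linear (\<lambda>y. y \<bullet> b)" by (rule bounded_linear_inner_left)
  have D: "frechet_derivative (\<lambda>y. g y \<bullet> b) (at y) w = frechet_derivative g (at y) w \<bullet> b"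
    if "smooth_on S g" "y \<in> S" for g :: "'a \<Rightarrow> 'b" and y w
    using frechet_derivative_eqI[OF bounded_linear.has_derivative[OF bl smooth_on_has_derivative[OF that]]]
    by simp
  have "frechet_derivative (\<lambda>y. frechet_derivative (\<lambda>y. f y \<bullet> b) (at y) w) (at x) w'
      = frechet_derivative (\<lambda>y. frechet_derivative f (at y) w) (at x) w' \<bullet> b" for w w'
  proof -
    have "frechet_derivative (\<lambda>y. frechet_derivative (\<lambda>y. f y \<bullet> b) (at y) w) (at x)
        = frechet_derivative (\<lambda>y. frechet_derivative f (at y) w \<bullet> b) (at x)"
      using assms D[OF f] smooth_on_differentiable[OF smooth_on_frechet_derivative[OF smooth_on_bounded_linear[OF _ bl]]]
      by (intro frechet_derivative_transform_within_open) auto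
    then show ?thesis using D[OF smooth_on_frechet_derivative[OF f] assms(2)] by simp
  qed
  with second_derivative_symmetric_real[OF assms(1,2) smooth_on_bounded_linear[OF assms(1) bl f]]
  show "frechet_derivative (\<lambda>y. frechet_derivative f (at y) u) (at x) v \<bullet> b =
    frechet_derivative (\<lambda>y. frechet_derivative f (at y) v) (at x) u \<bullet> b" by metis
qed

subsection \<open>Bilinear families\<close>

lemma bilinear_expand:
  fixes a :: "real^'n::finite \<Rightarrow> real^'n \<Rightarrow> 'v::real_vector"
  assumes "bilinear a"
  shows "a v w = (\<Sum>i\<in>UNIV. \<Sum>j\<in>UNIV. (v $ i) *\<^sub>R (w $ j) *\<^sub>R a (axis i 1) (axis j 1))"
proof -
  have "a v w = a (\<Sum>i\<in>UNIV. (v $ i) *\<^sub>R axis i 1) (\<Sum>j\<in>UNIV. (w $ j) *\<^sub>R axis j 1)"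
    by (simp add: basis_expansion flip: scalar_mult_eq_scaleR)
  also have "\<dots> = (\<Sum>(i,j)\<in>UNIV \<times> UNIV. a ((v $ i) *\<^sub>R axis i 1) ((w $ j) *\<^sub>R axis j 1))"
    using assms by (rule bilinear_sum)
  also have "\<dots> = (\<Sum>(i,j)\<in>UNIV \<times> UNIV. (v $ i) *\<^sub>R (w $ j) *\<^sub>R a (axis i 1) (axis j 1))"
    using assms by (simp add: bilinear_lmul bilinear_rmul)
  finally show ?thesis by (simp add: sum.cartesian_product)
qed

text \<open>Expansion along the standard basis leaves a finite sum of products, so smoothness of
  \<open>a\<close> on fixed vectors suffices even when the arguments move.\<close>

lemma smooth_on_bilinear_family:
  fixes V W :: "'x::real_normed_vector \<Rightarrow> real^'n::finite"
    and a :: "'x \<Rightarrow> real^'n \<Rightarrow> real^'n \<Rightarrow> 'v::real_normed_vector"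
  assumes S: "open S" and a: "\<And>x. x \<in> S \<Longrightarrow> bilinear (a x)" "\<And>v w. smooth_on S (\<lambda>x. a x v w)"
    and V: "smooth_on S V" and W: "smooth_on S W"
  shows "smooth_on S (\<lambda>x. a x (V x) (W x))"
proof (rule smooth_on_cong[OF S])
  show "smooth_on S (\<lambda>x. \<Sum>i\<in>UNIV. \<Sum>j\<in>UNIV. (V x $ i) *\<^sub>R (W x $ j) *\<^sub>R a x (axis i 1) (axis j 1))"
    using S a(2) V W by (intro smooth_on_sum smooth_on_scaleR smooth_on_bounded_linear[OF _ bounded_linear_vec_nth])
qed (simp add: a bilinear_expand[symmetric] del: scaleR_scaleR)

text \<open>The product rule for a tensor evaluated on moving vectors at a moving base point. It is
  needed for transition maps, where the Jacobians applied to the arguments vary as well.\<close>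

lemma has_derivative_bilinear_family:
  fixes V W :: "'x::real_normed_vector \<Rightarrow> real^'n::finite"
    and a :: "'y::real_normed_vector \<Rightarrow> real^'n \<Rightarrow> real^'n \<Rightarrow> 'v::real_normed_vector"
  assumes S: "open S" "x \<in> S" and a: "\<And>y. y \<in> S \<Longrightarrow> bilinear (a (\<phi> y))"
    and a': "\<And>v w. ((\<lambda>y. a y v w) has_derivative a' v w) (at (\<phi> x))"
    and \<phi>: "(\<phi> has_derivative \<phi>') (at x)"
    and V: "(V has_derivative V') (at x)" and W: "(W has_derivative W') (at x)"
  shows "((\<lambda>y. a (\<phi> y) (V y) (W y)) has_derivative
     (\<lambda>u. a (\<phi> x) (V' u) (W x) + a (\<phi> x) (V x) (W' u) + a' (V x) (W x) (\<phi>' u))) (at x)"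
proof -
  let ?e = "\<lambda>i. axis i 1 :: real^'n"
  have comp: "((\<lambda>y. a (\<phi> y) v w) has_derivative (\<lambda>u. a' v w (\<phi>' u))) (at x)" for v w
    using has_derivative_compose[OF \<phi> a'] .
  have "((\<lambda>y. \<Sum>i\<in>UNIV. \<Sum>j\<in>UNIV. (V y $ i) *\<^sub>R (W y $ j) *\<^sub>R a (\<phi> y) (?e i) (?e j)) has_derivative
      (\<lambda>u. \<Sum>i\<in>UNIV. \<Sum>j\<in>UNIV. (V x $ i) *\<^sub>R ((W x $ j) *\<^sub>R a' (?e i) (?e j) (\<phi>' u)
        + (W' u $ j) *\<^sub>R a (\<phi> x) (?e i) (?e j)) + (V' u $ i) *\<^sub>R (W x $ j) *\<^sub>R a (\<phi> x) (?e i) (?e j))) (at x)"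
    by (intro has_derivative_sum has_derivative_scaleR comp bounded_linear.has_derivative[OF bounded_linear_vec_nth] V W)
  moreover have "(\<lambda>u. \<Sum>i\<in>UNIV. \<Sum>j\<in>UNIV. (V x $ i) *\<^sub>R ((W x $ j) *\<^sub>R a' (?e i) (?e j) (\<phi>' u)
        + (W' u $ j) *\<^sub>R a (\<phi> x) (?e i) (?e j)) + (V' u $ i) *\<^sub>R (W x $ j) *\<^sub>R a (\<phi> x) (?e i) (?e j))
     = (\<lambda>u. a (\<phi> x) (V' u) (W x) + a (\<phi> x) (V x) (W' u) + a' (V x) (W x) (\<phi>' u))"
  proof
    fix u
    \<comment> \<open>No bilinearity of \<open>a'\<close> is assumed: along \<phi> it is inherited
      from \<open>a\<close>, because the expansion holds near \<open>x\<close> and derivatives are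
      unique.\<close>
    have "a' v w (\<phi>' u) = (\<Sum>i\<in>UNIV. \<Sum>j\<in>UNIV. (v $ i) *\<^sub>R (w $ j) *\<^sub>R a' (?e i) (?e j) (\<phi>' u))" for v w
    proof -
      have "((\<lambda>y. \<Sum>i\<in>UNIV. \<Sum>j\<in>UNIV. (v $ i) *\<^sub>R (w $ j) *\<^sub>R a (\<phi> y) (?e i) (?e j)) has_derivative
        (\<lambda>u. \<Sum>i\<in>UNIV. \<Sum>j\<in>UNIV. (v $ i) *\<^sub>R (w $ j) *\<^sub>R a' (?e i) (?e j) (\<phi>' u))) (at x)"
        by (intro has_derivative_sum has_derivative_scaleR_right comp)
      then have "((\<lambda>y. a (\<phi> y) v w) has_derivative
        (\<lambda>u. \<Sum>i\<in>UNIV. \<Sum>j\<in>UNIV. (v $ i) *\<^sub>R (w $ j) *\<^sub>R a' (?e i) (?e j) (\<phi>' u))) (at x)"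
        by (rule has_derivative_transform_within_open[OF _ S]) (simp add: a bilinear_expand[symmetric] del: scaleR_scaleR)
      from fun_cong[OF has_derivative_unique[OF comp this], of u] show ?thesis .
    qed
    from this[of "V x" "W x"]
    show "(\<Sum>i\<in>UNIV. \<Sum>j\<in>UNIV. (V x $ i) *\<^sub>R ((W x $ j) *\<^sub>R a' (?e i) (?e j) (\<phi>' u)
        + (W' u $ j) *\<^sub>R a (\<phi> x) (?e i) (?e j)) + (V' u $ i) *\<^sub>R (W x $ j) *\<^sub>R a (\<phi> x) (?e i) (?e j))
      = a (\<phi> x) (V' u) (W x) + a (\<phi> x) (V x) (W' u) + a' (V x) (W x) (\<phi>' u)"
      by (simp add: bilinear_expand[OF a[OF S(2)], of "V' u"] bilinear_expand[OF a[OF S(2)], of _ "W' u"]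
            scaleR_right_distrib sum.distrib)
  qed
  ultimately have "((\<lambda>y. \<Sum>i\<in>UNIV. \<Sum>j\<in>UNIV. (V y $ i) *\<^sub>R (W y $ j) *\<^sub>R a (\<phi> y) (?e i) (?e j)) has_derivative
      (\<lambda>u. a (\<phi> x) (V' u) (W x) + a (\<phi> x) (V x) (W' u) + a' (V x) (W x) (\<phi>' u))) (at x)"
    by argo
  then show ?thesis
    by (rule has_derivative_transform_within_open[OF _ S]) (simp add: a bilinear_expand[symmetric] del: scaleR_scaleR)
qed

section \<open>Change of charts\<close>

lemma chart_inv_left:
  "smooth_atlas M \<Longrightarrow> c \<in> M \<Longrightarrow> p \<in> fst c \<Longrightarrow> chart_inv c (snd c p) = p"
  unfolding smooth_atlas_def homeomorphism_def by metis

lemma chart_inv_right: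
  "smooth_atlas M \<Longrightarrow> c \<in> M \<Longrightarrow> x \<in> snd c ` fst c \<Longrightarrow> snd c (chart_inv c x) = x \<and> chart_inv c x \<in> fst c"
  unfolding smooth_atlas_def homeomorphism_def by (metis imageI)

lemma open_chart_image: "smooth_atlas M \<Longrightarrow> c \<in> M \<Longrightarrow> open (snd c ` fst c)"
  unfolding smooth_atlas_def by blast

lemma open_chart_overlap:
  assumes "smooth_atlas M" "c \<in> M" "c' \<in> M"
  shows "open (snd c ` (fst c \<inter> fst c'))"
proof -
  have "homeomorphism (fst c) (snd c ` fst c) (snd c) (chart_inv c)" "open (fst c')"
    using assms unfolding smooth_atlas_def by blast+
  then have "openin (top_of_set (snd c ` fst c)) (snd c ` (fst c \<inter> fst c'))"
    by (intro homeomorphism_imp_open_map[of "fst c"]) (auto simp: openin_open_Int)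
  then show ?thesis
    using open_chart_image[OF assms(1,2)] openin_open_trans by blast
qed

lemma smooth_on_transition:
  "smooth_atlas M \<Longrightarrow> c \<in> M \<Longrightarrow> c' \<in> M \<Longrightarrow> smooth_on (snd c ` (fst c \<inter> fst c')) (snd c' \<circ> chart_inv c)"
  unfolding smooth_atlas_def by blast

lemma has_derivative_transition:
  assumes "smooth_atlas M" "c \<in> M" "c' \<in> M" "p \<in> fst c" "p \<in> fst c'"
  shows "((snd c' \<circ> chart_inv c) has_derivative tchange c c' p) (at (snd c p))"
  unfolding tchange_def
  using assms by (intro smooth_on_has_derivative[OF smooth_on_transition]) auto

lemma linear_tchange:
  "smooth_atlas M \<Longrightarrow> c \<in> M \<Longrightarrow> c' \<in> M \<Longrightarrow> p \<in> fst c \<Longrightarrow> p \<in> fst c' \<Longrightarrow> linear (tchange c c' p)"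
  using has_derivative_transition has_derivative_linear by blast

lemma tchange_compose:
  assumes "smooth_atlas M" "c \<in> M" "c' \<in> M" "c'' \<in> M" "p \<in> fst c" "p \<in> fst c'" "p \<in> fst c''"
  shows "tchange c' c'' p (tchange c c' p v) = tchange c c'' p v"
proof -
  let ?S = "snd c ` (fst c \<inter> fst c')"
  have "((snd c'' \<circ> chart_inv c') has_derivative tchange c' c'' p) (at ((snd c' \<circ> chart_inv c) (snd c p)))"
    using has_derivative_transition[OF assms(1,3,4,6,7)] chart_inv_left[OF assms(1,2,5)] by simp
  from diff_chain_at[OF has_derivative_transition[OF assms(1,2,3,5,6)] this]
  have "((snd c'' \<circ> chart_inv c' \<circ> (snd c' \<circ> chart_inv c)) has_derivative (tchange c' c'' p \<circ> tchange c c' p)) (at (snd c p))" .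
  then have "((snd c'' \<circ> chart_inv c) has_derivative (tchange c' c'' p \<circ> tchange c c' p)) (at (snd c p))"
    by (rule has_derivative_transform_within_open[OF _ open_chart_overlap[OF assms(1,2,3)]])
       (use assms in \<open>auto simp: chart_inv_left\<close>)
  from has_derivative_unique[OF this has_derivative_transition[OF assms(1,2,4,5,7)]]
  show ?thesis by (metis comp_apply)
qed

lemma tchange_self:
  assumes "smooth_atlas M" "c \<in> M" "p \<in> fst c"
  shows "tchange c c p v = v"
proof -
  have "((\<lambda>x. x) has_derivative (\<lambda>x. x)) (at (snd c p))" by simp
  then have "((snd c \<circ> chart_inv c) has_derivative (\<lambda>x. x)) (at (snd c p))"
    by (rule has_derivative_transform_within_open[OF _ open_chart_image[OF assms(1,2)]])
       (use assms in \<open>auto simp: chart_inv_left\<close>)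
  from has_derivative_unique[OF this has_derivative_transition[OF assms(1,2,2,3,3)]]
  show ?thesis by metis
qed

lemma chart_at_in:
  assumes "smooth_atlas M"
  shows "chart_at M p \<in> M" "p \<in> fst (chart_at M p)"
proof -
  have "\<exists>c. c \<in> M \<and> p \<in> fst c" using assms unfolding smooth_atlas_def by blast
  then have "chart_at M p \<in> M \<and> p \<in> fst (chart_at M p)" unfolding chart_at_def by (rule someI_ex)
  then show "chart_at M p \<in> M" "p \<in> fst (chart_at M p)" by auto
qed

text \<open>Assuming \<open>smooth_atlas (insert c M)\<close> rather than \<open>c \<in> M\<close>
  admits holomorphic charts. The preferred chart also lies in the enlarged atlas, so the composition
  rule for Jacobians applies there.\<close>

lemma
  assumes "smooth_atlas M" "smooth_atlas (insert c M)" "p \<in> fst c"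
  shows linear_from_chart: "linear (from_chart M c p)"
    and from_to_chart: "from_chart M c p (to_chart M c p v) = v"
    and to_from_chart: "to_chart M c p (from_chart M c p v) = v"
  using assms chart_at_in[OF assms(1), of p]
    linear_tchange[OF assms(2), of c "chart_at M p" p]
    tchange_compose[OF assms(2), of c "chart_at M p" c p] tchange_compose[OF assms(2), of "chart_at M p" c "chart_at M p" p]
    tchange_self[OF assms(2)]
  unfolding from_chart_def to_chart_def by auto

lemma from_chart_at: "smooth_atlas M \<Longrightarrow> from_chart M (chart_at M p) p v = v"
  using chart_at_in tchange_self unfolding from_chart_def by metis

lemma coord_tensor_at:
  assumes "smooth_atlas M" "smooth_atlas (insert c M)" "p \<in> fst c"
  shows "coord_tensor M c \<alpha> (snd c p) vs = \<alpha> p (map (from_chart M c p) vs)"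
  unfolding coord_tensor_def using chart_inv_left[OF assms(2) _ assms(3)] by simp

lemma coord_tensor_change:
  assumes "smooth_atlas M" "smooth_atlas (insert c M)" "c' \<in> M" "p \<in> fst c" "p \<in> fst c'"
  shows "coord_tensor M c \<alpha> (snd c p) vs = coord_tensor M c' \<alpha> (snd c' p) (map (tchange c c' p) vs)"
proof -
  have "map (from_chart M c p) vs = map (from_chart M c' p) (map (tchange c c' p) vs)"
    using tchange_compose[OF assms(2), of c c' "chart_at M p" p] assms chart_at_in[OF assms(1), of p]
    by (auto simp: from_chart_def)
  moreover have "smooth_atlas (insert c' M)" using assms(1,3) by (simp add: insert_absorb)
  ultimately show ?thesis
    using coord_tensor_at[OF assms(1,2,4), of \<alpha> vs] coord_tensor_at[OF assms(1) _ assms(5), of \<alpha> "map (tchange c c' p) vs"]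
    by metis
qed

section \<open>Exterior derivative of 2-forms in a chart\<close>

definition coord_deriv ::
  "('m, 'n::finite) atlas \<Rightarrow> ('m, 'n) chart \<Rightarrow> ('m, 'n, 'v::real_normed_vector) tensor \<Rightarrow> 'm \<Rightarrow>
     real^'n \<Rightarrow> (real^'n) list \<Rightarrow> 'v" where
  "coord_deriv M c \<alpha> p u vs = frechet_derivative (\<lambda>x. coord_tensor M c \<alpha> x vs) (at (snd c p)) u"

lemma ext_d_2:
  "ext_d M \<alpha> p [u, v, w] = coord_deriv M (chart_at M p) \<alpha> p u [v, w]
     - coord_deriv M (chart_at M p) \<alpha> p v [u, w] + coord_deriv M (chart_at M p) \<alpha> p w [u, v]"
  by (simp add: ext_d_def coord_deriv_def numeral_eq_Suc)

lemma ext_d_3: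
  "ext_d M \<alpha> p [u, v, w, z] = coord_deriv M (chart_at M p) \<alpha> p u [v, w, z]
     - coord_deriv M (chart_at M p) \<alpha> p v [u, w, z] + coord_deriv M (chart_at M p) \<alpha> p w [u, v, z]
     - coord_deriv M (chart_at M p) \<alpha> p z [u, v, w]"
  by (simp add: ext_d_def coord_deriv_def numeral_eq_Suc)

lemma smooth_tensor_bilinear:
  assumes "smooth_tensor M 2 \<alpha>"
  shows "bilinear (\<lambda>v w. \<alpha> p [v, w])"
proof -
  have l: "linear (\<lambda>v. \<alpha> p (vs[i := v]))" if "length vs = 2" "i < 2" for vs i
    using assms that unfolding smooth_tensor_def by blast
  show ?thesis unfolding bilinear_def
  proof (intro conjI allI)
    show "linear (\<lambda>y. \<alpha> p [x, y])" for x using l[of "[x, 0]" 1] by simp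
    show "linear (\<lambda>x. \<alpha> p [x, y])" for y using l[of "[0, y]" 0] by simp
  qed
qed

lemma bilinear_compose:
  "bilinear a \<Longrightarrow> linear f \<Longrightarrow> linear g \<Longrightarrow> bilinear (\<lambda>v w. a (f v) (g w))"
  unfolding bilinear_def
  by (auto intro!: linearI simp: linear_add linear_scale
      linear_add[of "\<lambda>x. a x _"] linear_scale[of "\<lambda>x. a x _"])

lemma coord_tensor_bilinear:
  assumes "smooth_atlas M" "smooth_atlas (insert c M)" "smooth_tensor M 2 \<alpha>" "x \<in> snd c ` fst c"
  shows "bilinear (\<lambda>v w. coord_tensor M c \<alpha> x [v, w])"
proof -
  obtain p where p: "p \<in> fst c" "x = snd c p" using assms by auto
  have l: "linear (from_chart M c p)" by (rule linear_from_chart[OF assms(1,2) p(1)])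
  show ?thesis
    using bilinear_compose[OF smooth_tensor_bilinear[OF assms(3)] l l]
    by (simp add: coord_tensor_at[OF assms(1,2)] p)
qed

lemma smooth_tensor_smooth_on:
  assumes "smooth_atlas M" "smooth_tensor M k \<alpha>" "c \<in> M"
  shows "smooth_on (snd c ` fst c) (\<lambda>x. coord_tensor M c \<alpha> x vs)"
proof (cases "length vs = k")
  case True
  with assms show ?thesis unfolding smooth_tensor_def by blast
next
  case False
  with assms(2) have "(\<lambda>x. coord_tensor M c \<alpha> x vs) = (\<lambda>x. 0)"
    unfolding smooth_tensor_def coord_tensor_def by (auto simp: Let_def)
  then show ?thesis by (simp add: smooth_on_const)
qed

lemma coord_tensor_has_derivative_M:
  assumes "smooth_atlas M" "smooth_tensor M k \<alpha>" "c \<in> M" "p \<in> fst c"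
  shows "((\<lambda>x. coord_tensor M c \<alpha> x vs) has_derivative (\<lambda>u. coord_deriv M c \<alpha> p u vs)) (at (snd c p))"
  unfolding coord_deriv_def
  by (rule smooth_on_has_derivative[OF smooth_tensor_smooth_on[OF assms(1-3)]]) (use assms in auto)

text \<open>The second derivative \<open>D2\<close> of the transition map is symmetric, so that its contributions cancel
  in the alternating sum that defines the exterior derivative.\<close>

lemma coord_tensor_has_derivative_transition:
  fixes M :: "('m::{t2_space,second_countable_topology}, 'n::finite) atlas" and p :: 'm
  assumes M: "smooth_atlas M" and cM: "smooth_atlas (insert c M)" and p: "p \<in> fst c"
    and \<alpha>: "smooth_tensor M 2 \<alpha>"
  defines "c' \<equiv> chart_at M p"
  defines "D2 \<equiv> \<lambda>u v. frechet_derivative (\<lambda>x. frechet_derivative (snd c' \<circ> chart_inv c) (at x) v) (at (snd c p)) u"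
  defines "f \<equiv> from_chart M c p"
  shows "((\<lambda>x. coord_tensor M c \<alpha> x [v, w]) has_derivative
     (\<lambda>u. \<alpha> p [D2 u v, f w] + \<alpha> p [f v, D2 u w] + coord_deriv M c' \<alpha> p (f u) [f v, f w])) (at (snd c p))"
    (is "(_ has_derivative ?D) _")
    and "D2 u v = D2 v u"
proof -
  let ?\<phi> = "snd c' \<circ> chart_inv c"
  let ?S = "snd c ` (fst c \<inter> fst c')"
  let ?x = "snd c p"
  have c': "c' \<in> M" "p \<in> fst c'" using chart_at_in[OF M] by (simp_all add: c'_def)
  have inM: "c \<in> insert c M" "c' \<in> insert c M" using c' by auto
  have S: "open ?S" "?x \<in> ?S" using open_chart_overlap[OF cM inM] p c' by auto
  have sm: "smooth_on ?S ?\<phi>" by (rule smooth_on_transition[OF cM inM])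
  show "D2 u v = D2 v u" unfolding D2_def
    by (rule second_derivative_symmetric[OF S sm])
  have f: "f = frechet_derivative ?\<phi> (at ?x)"
    unfolding f_def from_chart_def tchange_def c'_def ..
  have \<phi>x: "?\<phi> ?x = snd c' p" using chart_inv_left[OF cM inM(1) p] by simp
  have at: "coord_tensor M c' \<alpha> (?\<phi> ?x) [v, w] = \<alpha> p [v, w]" for v w
    using coord_tensor_at[OF M _ c'(2), of \<alpha>] M c'(1) from_chart_at[OF M] \<phi>x
    by (simp add: insert_absorb c'_def)
  \<comment> \<open>On the overlap, the components in \<open>c\<close> are those in
    \<open>c'\<close> evaluated on vectors transported by the Jacobian of the transition map. The
    terms with \<open>D2\<close> come from differentiating this Jacobian.\<close>
  have "((\<lambda>y. coord_tensor M c' \<alpha> (?\<phi> y) [frechet_derivative ?\<phi> (at y) v, frechet_derivative ?\<phi> (at y) w])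
     has_derivative (\<lambda>u. coord_tensor M c' \<alpha> (?\<phi> ?x) [D2 u v, frechet_derivative ?\<phi> (at ?x) w]
       + coord_tensor M c' \<alpha> (?\<phi> ?x) [frechet_derivative ?\<phi> (at ?x) v, D2 u w]
       + coord_deriv M c' \<alpha> p (f u) [frechet_derivative ?\<phi> (at ?x) v, frechet_derivative ?\<phi> (at ?x) w])) (at ?x)"
  proof (rule has_derivative_bilinear_family[where a = "\<lambda>y v w. coord_tensor M c' \<alpha> y [v, w]" and \<phi> = ?\<phi>
        and a' = "\<lambda>v w u. coord_deriv M c' \<alpha> p u [v, w]", OF S])
    show "bilinear (\<lambda>v w. coord_tensor M c' \<alpha> (?\<phi> y) [v, w])" if "y \<in> ?S" for y
      using that chart_inv_left[OF cM inM(1)] M c'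
      by (intro coord_tensor_bilinear[OF M _ \<alpha>]) (auto simp: insert_absorb)
    show "((\<lambda>y. coord_tensor M c' \<alpha> y [v, w]) has_derivative (\<lambda>u. coord_deriv M c' \<alpha> p u [v, w])) (at (?\<phi> ?x))" for v w
      using coord_tensor_has_derivative_M[OF M \<alpha> c'] \<phi>x by simp
    show "(?\<phi> has_derivative f) (at ?x)" unfolding f by (rule smooth_on_has_derivative[OF sm S(2)])
    show "((\<lambda>y. frechet_derivative ?\<phi> (at y) v) has_derivative (\<lambda>u. D2 u v)) (at ?x)"
      "((\<lambda>y. frechet_derivative ?\<phi> (at y) w) has_derivative (\<lambda>u. D2 u w)) (at ?x)"
      unfolding D2_def by (rule smooth_on_has_derivative[OF smooth_on_frechet_derivative[OF sm] S(2)])+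
  qed
  then have "((\<lambda>y. coord_tensor M c' \<alpha> (?\<phi> y) [frechet_derivative ?\<phi> (at y) v, frechet_derivative ?\<phi> (at y) w])
     has_derivative ?D) (at ?x)"
    unfolding at f[symmetric] .
  then show "((\<lambda>x. coord_tensor M c \<alpha> x [v, w]) has_derivative ?D) (at ?x)"
  proof (rule has_derivative_transform_within_open[OF _ S])
    fix y assume "y \<in> ?S"
    then obtain q where q: "q \<in> fst c" "q \<in> fst c'" "y = snd c q" by auto
    show "coord_tensor M c' \<alpha> (?\<phi> y) [frechet_derivative ?\<phi> (at y) v, frechet_derivative ?\<phi> (at y) w]
        = coord_tensor M c \<alpha> y [v, w]"
      using coord_tensor_change[OF M cM c'(1) q(1,2), of \<alpha> "[v, w]"] q chart_inv_left[OF cM inM(1) q(1)]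
      by (simp add: tchange_def)
  qed
qed

text \<open>Smoothness of a tensor is only postulated in charts of \<open>M\<close>; in a merely
  compatible chart, differentiability comes from the transition formula.\<close>

lemma coord_tensor_has_derivative:
  assumes "smooth_atlas M" "smooth_atlas (insert c M)" "p \<in> fst c" "smooth_tensor M 2 \<alpha>"
  shows "((\<lambda>x. coord_tensor M c \<alpha> x [v, w]) has_derivative (\<lambda>u. coord_deriv M c \<alpha> p u [v, w])) (at (snd c p))"
  unfolding coord_deriv_def frechet_derivative_works[symmetric]
  by (rule differentiableI[OF coord_tensor_has_derivative_transition(1)[OF assms]])

lemma smooth_form_skew:
  assumes "smooth_form M 2 \<alpha>"
  shows "\<alpha> p [v, w] = - \<alpha> p [w, v]"
proof -
  have bl: "bilinear (\<lambda>v w. \<alpha> p [v, w])"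
    using assms smooth_tensor_bilinear[of M \<alpha> p] unfolding smooth_form_def by simp
  have "\<alpha> p vs = 0" if "length vs = 2 \<and> i < j \<and> j < 2 \<and> vs ! i = vs ! j" for vs i j
    using assms that unfolding smooth_form_def by blast
  from this[of "[x, x]" 0 1 for x] have "\<alpha> p [x, x] = 0" for x by simp
  from this[of "v + w"] this[of v] this[of w] show ?thesis
    using bilinear_ladd[OF bl] bilinear_radd[OF bl] by (simp add: eq_neg_iff_add_eq_0 add.commute)
qed

text \<open>Independence of the chart: \<open>ext_d\<close> is defined through the preferred chart
  at each point, and this formula allows computing it in a single chart around a point or in a
  holomorphic one.\<close>

lemma ext_d_2_chart:
  assumes M: "smooth_atlas M" and c: "smooth_atlas (insert c M)" "p \<in> fst c" and \<alpha>: "smooth_form M 2 \<alpha>"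
  shows "ext_d M \<alpha> p [from_chart M c p u, from_chart M c p v, from_chart M c p w] =
     coord_deriv M c \<alpha> p u [v, w] - coord_deriv M c \<alpha> p v [u, w] + coord_deriv M c \<alpha> p w [u, v]"
proof -
  have t: "smooth_tensor M 2 \<alpha>" using \<alpha> by (simp add: smooth_form_def)
  note d = coord_tensor_has_derivative_transition[OF M c t]
  show ?thesis
    unfolding ext_d_2 coord_deriv_def[of M c]
    by (simp add: frechet_derivative_eqI[OF d(1)] d(2)[of u v] d(2)[of u w] d(2)[of v w]
        smooth_form_skew[OF \<alpha>, of p "from_chart M c p _"])
qed

section \<open>Operations on tensors\<close>

lemma length_2E:
  assumes "length vs = 2" obtains v w where "vs = [v, w]"
  using assms by (auto simp: numeral_eq_Suc length_Suc_conv)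

lemma length_3E:
  assumes "length vs = 3" obtains u v w where "vs = [u, v, w]"
  using assms by (auto simp: numeral_eq_Suc length_Suc_conv)

lemma smooth_tensor_length: "smooth_tensor M k \<alpha> \<Longrightarrow> length vs \<noteq> k \<Longrightarrow> \<alpha> p vs = 0"
  by (simp add: smooth_tensor_def)

lemma smooth_form_length: "smooth_form M k \<alpha> \<Longrightarrow> length vs \<noteq> k \<Longrightarrow> \<alpha> p vs = 0"
  by (simp add: smooth_form_def smooth_tensor_def)

lemma smooth_form_tensor: "smooth_form M k \<alpha> \<Longrightarrow> smooth_tensor M k \<alpha>"
  by (simp add: smooth_form_def)

lemma coord_tensor_comp: "coord_tensor M c (\<lambda>p vs. h (\<alpha> p vs)) x vs = h (coord_tensor M c \<alpha> x vs)"
  by (simp add: coord_tensor_def Let_def)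

lemma coord_tensor_lincomb:
  "coord_tensor M c (\<lambda>p vs. a *\<^sub>R \<alpha> p vs + b *\<^sub>R \<beta> p vs) x vs
     = a *\<^sub>R coord_tensor M c \<alpha> x vs + b *\<^sub>R coord_tensor M c \<beta> x vs"
  by (simp add: coord_tensor_def Let_def)

lemma smooth_tensor_bounded_linear:
  assumes "smooth_atlas M" "bounded_linear h" "smooth_tensor M k \<alpha>"
  shows "smooth_tensor M k (\<lambda>p vs. h (\<alpha> p vs))"
proof -
  have "linear h" using assms(2) bounded_linear.linear by blast
  then have "linear (\<lambda>v. h (\<alpha> p (vs[i := v])))" if "length vs = k \<and> i < k" for p vs i
    using assms(3) that linear_compose[of "\<lambda>v. \<alpha> p (vs[i := v])" h]
    unfolding smooth_tensor_def comp_def by blast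
  moreover have "h 0 = 0" using \<open>linear h\<close> linear_0 by blast
  moreover have "smooth_on (snd c ` fst c) (\<lambda>x. h (coord_tensor M c \<alpha> x vs))" if "c \<in> M" "length vs = k" for c vs
    using assms(3) that unfolding smooth_tensor_def
    by (intro smooth_on_bounded_linear[OF open_chart_image[OF assms(1)] assms(2)]) simp_all
  ultimately show ?thesis
    using assms(3) unfolding smooth_tensor_def coord_tensor_comp by simp
qed

lemma smooth_form_bounded_linear:
  assumes "smooth_atlas M" "bounded_linear h" "smooth_form M k \<alpha>"
  shows "smooth_form M k (\<lambda>p vs. h (\<alpha> p vs))"
proof -
  have "h 0 = 0" using assms(2) bounded_linear.linear linear_0 by blast
  then show ?thesis
    using assms(3) smooth_tensor_bounded_linear[OF assms(1,2)] unfolding smooth_form_def by metis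
qed

lemma smooth_tensor_lincomb:
  assumes "smooth_atlas M" "smooth_tensor M k \<alpha>" "smooth_tensor M k \<beta>"
  shows "smooth_tensor M k (\<lambda>p vs. a *\<^sub>R \<alpha> p vs + b *\<^sub>R \<beta> p vs)"
proof -
  have "linear (\<lambda>v. a *\<^sub>R \<alpha> p (vs[i := v]) + b *\<^sub>R \<beta> p (vs[i := v]))" if "length vs = k \<and> i < k" for p vs i
    using assms(2,3) that unfolding smooth_tensor_def
    by (intro linear_compose_add linear_compose_scale_right) blast+
  moreover have "smooth_on (snd c ` fst c) (\<lambda>x. a *\<^sub>R coord_tensor M c \<alpha> x vs + b *\<^sub>R coord_tensor M c \<beta> x vs)"
    if "c \<in> M" "length vs = k" for c vs
    using assms(2,3) that unfolding smooth_tensor_def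
    by (intro smooth_on_add smooth_on_bounded_linear[OF _ bounded_linear_scaleR_right] open_chart_image[OF assms(1)]) simp_all
  ultimately show ?thesis
    using assms(2,3) unfolding smooth_tensor_def coord_tensor_lincomb by simp
qed

lemma smooth_form_lincomb:
  assumes "smooth_atlas M" "smooth_form M k \<alpha>" "smooth_form M k \<beta>"
  shows "smooth_form M k (\<lambda>p vs. a *\<^sub>R \<alpha> p vs + b *\<^sub>R \<beta> p vs)"
  unfolding smooth_form_def
proof (intro conjI allI impI)
  show "smooth_tensor M k (\<lambda>p vs. a *\<^sub>R \<alpha> p vs + b *\<^sub>R \<beta> p vs)"
    using assms by (intro smooth_tensor_lincomb smooth_form_tensor)
  show "a *\<^sub>R \<alpha> p vs + b *\<^sub>R \<beta> p vs = 0" if "length vs = k \<and> i < j \<and> j < k \<and> vs ! i = vs ! j" for p vs i j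
  proof -
    have "\<alpha> p vs = 0" "\<beta> p vs = 0" using assms that unfolding smooth_form_def by blast+
    then show ?thesis by simp
  qed
qed

lemma ext_d_zero: "ext_d M (\<lambda>p vs. 0) p vs = 0"
  by (simp add: ext_d_def coord_tensor_def)

lemma ext_d_length:
  assumes "smooth_tensor M k \<alpha>" "length vs \<noteq> Suc k"
  shows "ext_d M \<alpha> p vs = 0"
  unfolding ext_d_def
proof (rule sum.neutral, intro ballI)
  fix i assume "i \<in> {..<length vs}"
  then have "(\<lambda>x. coord_tensor M (chart_at M p) \<alpha> x (take i vs @ drop (Suc i) vs)) = (\<lambda>x. 0)"
    using assms(2) by (auto simp: coord_tensor_def Let_def smooth_tensor_length[OF assms(1)])
  then show "(- 1) ^ i *\<^sub>R frechet_derivative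
       (\<lambda>x. coord_tensor M (chart_at M p) \<alpha> x (take i vs @ drop (Suc i) vs))
       (at (snd (chart_at M p) p)) (vs ! i) = 0" by simp
qed

lemma ext_d_bounded_linear:
  assumes M: "smooth_atlas M" and h: "bounded_linear h" and \<alpha>: "smooth_tensor M k \<alpha>"
  shows "ext_d M (\<lambda>p vs. h (\<alpha> p vs)) p vs = h (ext_d M \<alpha> p vs)"
proof -
  have l: "linear h" using h bounded_linear.linear by blast
  have "frechet_derivative (\<lambda>x. h (coord_tensor M (chart_at M p) \<alpha> x ws)) (at (snd (chart_at M p) p))
     = (\<lambda>u. h (coord_deriv M (chart_at M p) \<alpha> p u ws))" for ws
    using chart_at_in[OF M]
    by (intro frechet_derivative_eqI bounded_linear.has_derivative[OF h] coord_tensor_has_derivative_M[OF M \<alpha>])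
  then show ?thesis
    by (simp add: ext_d_def coord_tensor_comp coord_deriv_def linear_sum[OF l] linear_scale[OF l])
qed

lemma ext_d_lincomb:
  assumes M: "smooth_atlas M" and \<alpha>: "smooth_tensor M k \<alpha>" and \<beta>: "smooth_tensor M k \<beta>"
  shows "ext_d M (\<lambda>p vs. a *\<^sub>R \<alpha> p vs + b *\<^sub>R \<beta> p vs) p vs = a *\<^sub>R ext_d M \<alpha> p vs + b *\<^sub>R ext_d M \<beta> p vs"
proof -
  have "frechet_derivative (\<lambda>x. a *\<^sub>R coord_tensor M (chart_at M p) \<alpha> x ws + b *\<^sub>R coord_tensor M (chart_at M p) \<beta> x ws)
      (at (snd (chart_at M p) p))
     = (\<lambda>u. a *\<^sub>R coord_deriv M (chart_at M p) \<alpha> p u ws + b *\<^sub>R coord_deriv M (chart_at M p) \<beta> p u ws)" for ws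
    using chart_at_in[OF M]
    by (intro frechet_derivative_eqI has_derivative_add has_derivative_scaleR_right
        coord_tensor_has_derivative_M[OF M \<alpha>] coord_tensor_has_derivative_M[OF M \<beta>])
  then show ?thesis
    by (simp add: ext_d_def coord_tensor_lincomb coord_deriv_def sum.distrib scaleR_right_distrib
        scaleR_sum_right mult.commute)
qed

lemma smooth_tensor_2I:
  assumes "\<And>p vs. length vs \<noteq> 2 \<Longrightarrow> \<alpha> p vs = 0" "\<And>p. bilinear (\<lambda>v w. \<alpha> p [v, w])"
    and "\<And>c v w. c \<in> M \<Longrightarrow> smooth_on (snd c ` fst c) (\<lambda>x. coord_tensor M c \<alpha> x [v, w])"
  shows "smooth_tensor M 2 \<alpha>"
  unfolding smooth_tensor_def
proof (intro conjI allI impI ballI)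
  show "linear (\<lambda>v. \<alpha> p (vs[i := v]))" if vs: "length vs = 2 \<and> i < 2" for p vs i
  proof -
    obtain v w where uv: "vs = [v, w]" using vs by (auto elim: length_2E)
    have "i = 0 \<or> i = 1" using vs by auto
    then show ?thesis using assms(2)[of p] by (auto simp: bilinear_def uv)
  qed
  show "smooth_on (snd c ` fst c) (\<lambda>x. coord_tensor M c \<alpha> x vs)" if "c \<in> M" "length vs = 2" for c vs
    using that assms(3)[OF that(1)] length_2E by metis
qed (use assms(1) in auto)

lemma smooth_form_2I:
  assumes "smooth_tensor M 2 \<alpha>" "\<And>p v. \<alpha> p [v, v] = 0"
  shows "smooth_form M 2 \<alpha>"
  unfolding smooth_form_def
proof (intro conjI allI impI)
  show "\<alpha> p vs = 0" if vs: "length vs = 2 \<and> i < j \<and> j < 2 \<and> vs ! i = vs ! j" for p vs i j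
  proof -
    obtain v w where uv: "vs = [v, w]" using vs by (auto elim: length_2E)
    have ij: "i = 0 \<and> j = 1" using vs by auto
    show ?thesis using vs assms(2)[of p v] by (simp add: uv ij)
  qed
qed (rule assms)

lemma smooth_form_diag: "smooth_form M 2 \<alpha> \<Longrightarrow> \<alpha> p [v, v] = 0"
  unfolding smooth_form_def by (elim conjE allE[of _ p] allE[of _ "[v, v]"] allE[of _ 0] allE[of _ "1::nat"]) simp

lemma smooth_tensor_rev:
  assumes "smooth_tensor M 2 \<alpha>"
  shows "smooth_tensor M 2 (\<lambda>p vs. \<alpha> p (rev vs))"
proof (rule smooth_tensor_2I)
  show "bilinear (\<lambda>v w. \<alpha> p (rev [v, w]))" for p
    using smooth_tensor_bilinear[OF assms, of p] by (simp add: bilinear_def)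
  show "smooth_on (snd c ` fst c) (\<lambda>x. coord_tensor M c (\<lambda>p vs. \<alpha> p (rev vs)) x [v, w])" if "c \<in> M" for c v w
  proof -
    have "coord_tensor M c (\<lambda>p vs. \<alpha> p (rev vs)) x [v, w] = coord_tensor M c \<alpha> x [w, v]" for x
      by (simp add: coord_tensor_def Let_def)
    then show ?thesis using assms that unfolding smooth_tensor_def by simp
  qed
qed (use smooth_tensor_length[OF assms] in auto)

subsection \<open>Composition with endomorphisms\<close>

definition coord_endo ::
  "('m, 'n::finite) atlas \<Rightarrow> ('m, 'n) chart \<Rightarrow> ('m \<Rightarrow> real^'n \<Rightarrow> real^'n) \<Rightarrow> real^'n \<Rightarrow> real^'n \<Rightarrow> real^'n" where
  "coord_endo M c A x v = (let q = chart_inv c x in to_chart M c q (A q (from_chart M c q v)))"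

definition smooth_endo :: "('m, 'n::finite) atlas \<Rightarrow> ('m \<Rightarrow> real^'n \<Rightarrow> real^'n) \<Rightarrow> bool" where
  "smooth_endo M A \<longleftrightarrow> (\<forall>p. linear (A p)) \<and> (\<forall>c\<in>M. \<forall>v. smooth_on (snd c ` fst c) (\<lambda>x. coord_endo M c A x v))"

lemma smooth_endo_complex_structure: "complex_structure M J \<Longrightarrow> smooth_endo M J"
  unfolding complex_structure_def smooth_endo_def coord_endo_def by blast

lemma smooth_endo_id:
  assumes "smooth_atlas M"
  shows "smooth_endo M (\<lambda>p v. v)"
  unfolding smooth_endo_def
proof (intro conjI allI ballI)
  fix c v assume c: "c \<in> M"
  then have "v = coord_endo M c (\<lambda>p v. v) x v" if "x \<in> snd c ` fst c" for x
    using chart_inv_right[OF assms c that] to_from_chart[OF assms] assms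
    by (simp add: coord_endo_def Let_def insert_absorb)
  from smooth_on_cong[OF open_chart_image[OF assms c] this smooth_on_const]
  show "smooth_on (snd c ` fst c) (\<lambda>x. coord_endo M c (\<lambda>p v. v) x v)" .
qed (rule linear_id[unfolded id_def])

text \<open>One operation covers \<open>precomp\<close> (second endomorphism the identity),
  \<open>conjugate_by\<close> (both equal to \<open>J\<close>) and insertion of \<open>J\<close>
  into the second slot alone, so smoothness and derivatives need one proof only.\<close>

definition twist ::
  "('m, 'n::finite, 'v::zero) tensor \<Rightarrow> ('m \<Rightarrow> real^'n \<Rightarrow> real^'n) \<Rightarrow> ('m \<Rightarrow> real^'n \<Rightarrow> real^'n) \<Rightarrow> ('m, 'n, 'v) tensor" where
  "twist F A B p vs = (if length vs = 2 then F p [A p (vs ! 0), B p (vs ! 1)] else 0)"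

lemma twist_2 [simp]: "twist F A B p [v, w] = F p [A p v, B p w]"
  by (simp add: twist_def)

lemma smooth_tensor_twist:
  assumes M: "smooth_atlas M" and F: "smooth_tensor M 2 F" and A: "smooth_endo M A" and B: "smooth_endo M B"
  shows "smooth_tensor M 2 (twist F A B)"
proof (rule smooth_tensor_2I)
  show "bilinear (\<lambda>v w. twist F A B p [v, w])" for p
    using bilinear_compose[OF smooth_tensor_bilinear[OF F, of p], of "A p" "B p"] A B by (simp add: smooth_endo_def)
  fix c v w assume c: "c \<in> M"
  then have cM: "smooth_atlas (insert c M)" using M by (simp add: insert_absorb)
  show "smooth_on (snd c ` fst c) (\<lambda>x. coord_tensor M c (twist F A B) x [v, w])"
  proof (rule smooth_on_cong[OF open_chart_image[OF M c]])
    show "smooth_on (snd c ` fst c) (\<lambda>x. coord_tensor M c F x [coord_endo M c A x v, coord_endo M c B x w])"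
    proof (rule smooth_on_bilinear_family[OF open_chart_image[OF M c]])
      show "smooth_on (snd c ` fst c) (\<lambda>x. coord_endo M c A x v)" "smooth_on (snd c ` fst c) (\<lambda>x. coord_endo M c B x w)"
        using A B c by (simp_all add: smooth_endo_def)
    qed (rule coord_tensor_bilinear[OF M cM F] smooth_tensor_smooth_on[OF M F c], assumption?)+
    show "coord_tensor M c F x [coord_endo M c A x v, coord_endo M c B x w] = coord_tensor M c (twist F A B) x [v, w]"
      if "x \<in> snd c ` fst c" for x
      using chart_inv_right[OF M c that] from_to_chart[OF M cM] by (simp add: coord_tensor_def coord_endo_def Let_def)
  qed
qed (simp add: twist_def)

text \<open>Endomorphisms with constant components in \<open>c\<close> contribute nothing to the
  product rule: only the coefficients of \<open>F\<close> are differentiated.\<close>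

lemma coord_deriv_twist_const:
  assumes M: "smooth_atlas M" and c: "smooth_atlas (insert c M)" "p \<in> fst c" and F: "smooth_tensor M 2 F"
    and A: "\<And>q v. q \<in> fst c \<Longrightarrow> A q (from_chart M c q v) = from_chart M c q (A0 v)"
    and B: "\<And>q v. q \<in> fst c \<Longrightarrow> B q (from_chart M c q v) = from_chart M c q (B0 v)"
  shows "coord_deriv M c (twist F A B) p u [v, w] = coord_deriv M c F p u [A0 v, B0 w]"
proof -
  have "frechet_derivative (\<lambda>x. coord_tensor M c F x [A0 v, B0 w]) (at (snd c p))
      = frechet_derivative (\<lambda>x. coord_tensor M c (twist F A B) x [v, w]) (at (snd c p))"
  proof (rule frechet_derivative_transform_within_open[OF _ open_chart_image[OF c(1)]])
    show "(\<lambda>x. coord_tensor M c F x [A0 v, B0 w]) differentiable at (snd c p)"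
      by (rule differentiableI[OF coord_tensor_has_derivative[OF M c F]])
    show "coord_tensor M c F x [A0 v, B0 w] = coord_tensor M c (twist F A B) x [v, w]" if "x \<in> snd c ` fst c" for x
      using chart_inv_right[OF c(1) _ that] A B by (simp add: coord_tensor_def Let_def)
  qed (use c in auto)
  then show ?thesis by (simp add: coord_deriv_def)
qed

lemma coord_deriv_add:
  assumes M: "smooth_atlas M" and c: "smooth_atlas (insert c M)" "p \<in> fst c"
    and F: "smooth_tensor M 2 F" and G: "smooth_tensor M 2 G"
  shows "coord_deriv M c (\<lambda>p vs. F p vs + G p vs) p u [v, w] = coord_deriv M c F p u [v, w] + coord_deriv M c G p u [v, w]"
proof -
  have "coord_tensor M c (\<lambda>p vs. F p vs + G p vs) x vs = coord_tensor M c F x vs + coord_tensor M c G x vs" for x vs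
    by (simp add: coord_tensor_def Let_def)
  then show ?thesis
    unfolding coord_deriv_def[of M c "\<lambda>p vs. F p vs + G p vs"]
    by (simp add: frechet_derivative_eqI[OF has_derivative_add[OF coord_tensor_has_derivative[OF M c F] coord_tensor_has_derivative[OF M c G]]])
qed

lemma linear_coord_deriv:
  assumes "smooth_atlas M" "smooth_atlas (insert c M)" "p \<in> fst c" "smooth_tensor M 2 F"
  shows "linear (\<lambda>u. coord_deriv M c F p u [v, w])"
  using has_derivative_linear[OF coord_tensor_has_derivative[OF assms]] .

text \<open>Each identity holds for the components throughout the open chart image, so uniqueness of
  derivatives passes it to the derivative at the point.\<close>

lemma bilinear_coord_deriv:
  assumes M: "smooth_atlas M" and c: "smooth_atlas (insert c M)" "p \<in> fst c" and F: "smooth_tensor M 2 F"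
  shows "bilinear (\<lambda>v w. coord_deriv M c F p u [v, w])"
proof -
  note d = coord_tensor_has_derivative[OF M c F]
  have bl: "bilinear (\<lambda>v w. coord_tensor M c F x [v, w])" if "x \<in> snd c ` fst c" for x
    by (rule coord_tensor_bilinear[OF M c(1) F that])
  have eq: "f' = g'" if "(f has_derivative f') (at (snd c p))" "(g has_derivative g') (at (snd c p))"
    "\<And>x. x \<in> snd c ` fst c \<Longrightarrow> f x = g x" for f g :: "real^'b \<Rightarrow> 'c" and f' g'
  proof (rule has_derivative_unique[OF that(1)])
    show "(f has_derivative g') (at (snd c p))"
      by (rule has_derivative_transform_within_open[OF that(2) open_chart_image[OF c(1)]]) (use c(2) that(3) in auto)
  qed
  show ?thesis unfolding bilinear_def
  proof (intro conjI allI linearI)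
    fix v w w' r
    show "coord_deriv M c F p u [v, w + w'] = coord_deriv M c F p u [v, w] + coord_deriv M c F p u [v, w']"
      by (rule fun_cong[OF eq[OF d has_derivative_add[OF d d]]]) (rule bilinear_radd[OF bl])
    show "coord_deriv M c F p u [v, r *\<^sub>R w] = r *\<^sub>R coord_deriv M c F p u [v, w]"
      by (rule fun_cong[OF eq[OF d has_derivative_scaleR_right[OF d]]]) (rule bilinear_rmul[OF bl])
    show "coord_deriv M c F p u [w + w', v] = coord_deriv M c F p u [w, v] + coord_deriv M c F p u [w', v]"
      by (rule fun_cong[OF eq[OF d has_derivative_add[OF d d]]]) (rule bilinear_ladd[OF bl])
    show "coord_deriv M c F p u [r *\<^sub>R w, v] = r *\<^sub>R coord_deriv M c F p u [w, v]"
      by (rule fun_cong[OF eq[OF d has_derivative_scaleR_right[OF d]]]) (rule bilinear_lmul[OF bl])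
  qed
qed

subsection \<open>The exterior derivative of a 2-form is a closed 3-form\<close>

lemma coord_deriv_skew:
  assumes M: "smooth_atlas M" and c: "smooth_atlas (insert c M)" "p \<in> fst c" and F: "smooth_form M 2 F"
  shows "coord_deriv M c F p u [v, w] = - coord_deriv M c F p u [w, v]"
proof -
  have "coord_tensor M c F x [v, w] = - coord_tensor M c F x [w, v]" for x
    using smooth_form_skew[OF F, of "chart_inv c x" "from_chart M c (chart_inv c x) v"]
    by (simp add: coord_tensor_def Let_def)
  then show ?thesis
    unfolding coord_deriv_def[of M c F p u "[v, w]"]
    by (simp add: frechet_derivative_eqI[OF has_derivative_minus[OF coord_tensor_has_derivative[OF M c smooth_form_tensor[OF F]]]])
qed

text \<open>The preferred chart jumps from point to point, so smoothness is visible only after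
  \<open>ext_d_2_chart\<close> has rewritten the derivative in one fixed chart.\<close>

lemma smooth_form_ext_d:
  fixes F :: "('m::{t2_space,second_countable_topology}, 'n::finite, 'v::real_normed_vector) tensor"
  assumes M: "smooth_atlas M" and F: "smooth_form M 2 F"
  shows "smooth_form M 3 (ext_d M F)"
  unfolding smooth_form_def smooth_tensor_def
proof (intro conjI allI impI ballI)
  note t = smooth_form_tensor[OF F]
  have at: "smooth_atlas (insert (chart_at M p) M)" for p
    using M chart_at_in(1)[OF M] by (simp add: insert_absorb)
  note lin = linear_coord_deriv[OF M at chart_at_in(2)[OF M] t]
  note bil = bilinear_coord_deriv[OF M at chart_at_in(2)[OF M] t]
  note skew = coord_deriv_skew[OF M at chart_at_in(2)[OF M] F]
  show "ext_d M F p vs = 0" if "length vs \<noteq> 3" for p vs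
    using ext_d_length[OF t] that by simp
  show "linear (\<lambda>v. ext_d M F p (vs[i := v]))" if vs: "length vs = 3 \<and> i < 3" for p vs i
  proof -
    obtain u v w where uvw: "vs = [u, v, w]" using vs by (auto elim: length_3E)
    have l: "linear (\<lambda>v. coord_deriv M (chart_at M p) F p u [v, w])" "linear (\<lambda>v. coord_deriv M (chart_at M p) F p u [w, v])" for u w
      using bil[of p u] by (auto simp: bilinear_def)
    have "i = 0 \<or> i = 1 \<or> i = 2" using vs by auto
    then show ?thesis
      by (auto simp: uvw ext_d_2 intro!: linear_compose_add linear_compose_sub lin l)
  qed
  show "smooth_on (snd c ` fst c) (\<lambda>x. coord_tensor M c (ext_d M F) x vs)" if c: "c \<in> M" and vs: "length vs = 3" for c vs
  proof -
    obtain u v w where uvw: "vs = [u, v, w]" using vs by (auto elim: length_3E)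
    let ?D = "\<lambda>x u vs. frechet_derivative (\<lambda>x. coord_tensor M c F x vs) (at x) u"
    have cM: "smooth_atlas (insert c M)" using M c by (simp add: insert_absorb)
    have D: "smooth_on (snd c ` fst c) (\<lambda>x. ?D x u vs)" for u vs
      by (rule smooth_on_frechet_derivative[OF smooth_tensor_smooth_on[OF M t c]])
    show ?thesis
    proof (rule smooth_on_cong[OF open_chart_image[OF M c]])
      show "smooth_on (snd c ` fst c) (\<lambda>x. ?D x u [v, w] + (- ?D x v [u, w]) + ?D x w [u, v])"
        by (intro smooth_on_add open_chart_image[OF M c] D
            smooth_on_bounded_linear[OF _ bounded_linear_minus[OF bounded_linear_ident]])
      show "?D x u [v, w] + (- ?D x v [u, w]) + ?D x w [u, v] = coord_tensor M c (ext_d M F) x vs"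
        if x: "x \<in> snd c ` fst c" for x
      proof -
        obtain p where p: "p \<in> fst c" "x = snd c p" using x by blast
        show ?thesis
          using ext_d_2_chart[OF M cM p(1) F, of u v w] coord_tensor_at[OF M cM p(1), of "ext_d M F" vs]
          by (simp add: p uvw coord_deriv_def)
      qed
    qed
  qed
  show "ext_d M F p vs = 0" if vs: "length vs = 3 \<and> i < j \<and> j < 3 \<and> vs ! i = vs ! j" for p vs i j
  proof -
    obtain u v w where uvw: "vs = [u, v, w]" using vs by (auto elim: length_3E)
    have 0: "coord_deriv M (chart_at M p) F p u [v, v] = 0" for u v
    proof -
      have "coord_tensor M c F x [v, v] = 0" for c x
        using smooth_form_diag[OF F] by (simp add: coord_tensor_def Let_def)
      then show ?thesis by (simp add: coord_deriv_def)
    qed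
    have "i = 0 \<and> j = 1 \<or> i = 0 \<and> j = 2 \<or> i = 1 \<and> j = 2" using vs by auto
    then consider "u = v" | "u = w" | "v = w" using vs by (auto simp: uvw)
    then show ?thesis
    proof cases
      case 2
      \<comment> \<open>The equal arguments are not adjacent here: the two outer terms of the
        alternating sum survive and cancel by skew-symmetry.\<close>
      then show ?thesis using skew[of p u u v] by (simp add: uvw ext_d_2 0)
    qed (simp_all add: uvw ext_d_2 0)
  qed
qed

text \<open>Applying \<open>d\<close> twice yields twelve second derivatives of coefficients in one
  chart, which cancel in six pairs by symmetry.\<close>

lemma closed_form_ext_d:
  fixes F :: "('m::{t2_space,second_countable_topology}, 'n::finite, 'v::euclidean_space) tensor"
  assumes M: "smooth_atlas M" and F: "smooth_form M 2 F"
  shows "closed_form M (ext_d M F)"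
  unfolding closed_form_def
proof (intro allI)
  fix p vs
  note t = smooth_form_tensor[OF F]
  define c where "c = chart_at M p"
  have c: "c \<in> M" "p \<in> fst c" using chart_at_in[OF M] by (simp_all add: c_def)
  have cM: "smooth_atlas (insert c M)" using M c by (simp add: insert_absorb)
  define S where "S = snd c ` fst c"
  have S: "open S" "snd c p \<in> S" using open_chart_image[OF M c(1)] c(2) by (auto simp: S_def)
  define f where "f vs x = coord_tensor M c F x vs" for vs x
  have f: "smooth_on S (f vs)" for vs
    unfolding f_def S_def by (rule smooth_tensor_smooth_on[OF M t c(1)])
  define D where "D u vs x = frechet_derivative (f vs) (at x) u" for u vs x
  define DD where "DD u v vs = frechet_derivative (D v vs) (at (snd c p)) u" for u v vs
  have D: "(D v vs has_derivative (\<lambda>u. DD u v vs)) (at (snd c p))" for v vs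
    unfolding DD_def D_def by (rule smooth_on_has_derivative[OF smooth_on_frechet_derivative[OF f] S(2)])
  have sym: "DD u v vs = DD v u vs" for u v vs
    unfolding DD_def D_def using second_derivative_symmetric[OF S f] .
  \<comment> \<open>At points near \<open>p\<close> the value of \<open>ext_d\<close> refers to
    other preferred charts; it is expressed in the fixed chart \<open>c\<close> before being
    differentiated a second time.\<close>
  have d: "coord_deriv M c (ext_d M F) p u [v, w, z] = DD u v [w, z] - DD u w [v, z] + DD u z [v, w]" for u v w z
  proof -
    have "((\<lambda>x. D v [w, z] x - D w [v, z] x + D z [v, w] x) has_derivative
        (\<lambda>u. DD u v [w, z] - DD u w [v, z] + DD u z [v, w])) (at (snd c p))"
      by (intro has_derivative_add has_derivative_diff D)
    then have "((\<lambda>x. coord_tensor M c (ext_d M F) x [v, w, z]) has_derivative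
        (\<lambda>u. DD u v [w, z] - DD u w [v, z] + DD u z [v, w])) (at (snd c p))"
    proof (rule has_derivative_transform_within_open[OF _ S])
      fix x assume "x \<in> S"
      then obtain q where q: "q \<in> fst c" "x = snd c q" by (auto simp: S_def)
      show "D v [w, z] x - D w [v, z] x + D z [v, w] x = coord_tensor M c (ext_d M F) x [v, w, z]"
        using ext_d_2_chart[OF M cM q(1) F, of v w z] coord_tensor_at[OF M cM q(1), of "ext_d M F" "[v, w, z]"]
        by (simp add: q coord_deriv_def D_def f_def[abs_def])
    qed
    from frechet_derivative_eqI[OF this] show ?thesis by (simp add: coord_deriv_def)
  qed
  show "ext_d M (ext_d M F) p vs = 0"
  proof (cases "length vs = 4")
    case True
    then obtain u v w z where "vs = [u, v, w, z]" by (auto simp: numeral_eq_Suc length_Suc_conv)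
    then show ?thesis
      using sym[of v u] sym[of w u] sym[of z u] sym[of w v] sym[of z v] sym[of z w]
      by (simp add: ext_d_3 c_def[symmetric] d)
  next
    case False
    then show ?thesis using ext_d_length[OF smooth_form_tensor[OF smooth_form_ext_d[OF M F]]] by simp
  qed
qed

section \<open>The exterior derivative and an integrable complex structure\<close>

lemma complex_structure_linear: "complex_structure M J \<Longrightarrow> linear (J p)"
  and complex_structure_square: "complex_structure M J \<Longrightarrow> J p (J p v) = - v"
  by (simp_all add: complex_structure_def)

text \<open>Integrability in the form used later: \<open>J\<close> is moved across
  \<open>from_chart\<close>, since \<open>coord_tensor\<close> feeds coordinate vectors into a
  tensor through that map.\<close>

lemma complex_structure_adapted_chart:
  assumes M: "smooth_atlas M" and J: "complex_structure M J"
  obtains c J0 where "smooth_atlas (insert c M)" "p \<in> fst c" "\<And>v. J0 (J0 v) = - v"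
    "\<And>q v. q \<in> fst c \<Longrightarrow> J q (from_chart M c q v) = from_chart M c q (J0 v)"
proof -
  from J obtain c J0 where c: "p \<in> fst c" "smooth_atlas (insert c M)" "\<forall>v. J0 (J0 v) = - v"
    "\<forall>q\<in>fst c. \<forall>v. to_chart M c q (J q v) = J0 (to_chart M c q v)"
    unfolding complex_structure_def by blast
  have "J q (from_chart M c q v) = from_chart M c q (J0 v)" if "q \<in> fst c" for q v
    using c(4) that from_to_chart[OF M c(2) that] to_from_chart[OF M c(2) that] by metis
  with c show thesis by (intro that) auto
qed

text \<open>In a chart in which \<open>J\<close> is constant, both sides are the same combination of the first
  derivatives of the components of \<open>F\<close>; this is where integrability enters.\<close>

lemma ext_d_twist_identity:
  fixes F :: "('m::{t2_space,second_countable_topology}, 'n::finite, real) tensor"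
  assumes M: "smooth_atlas M" and J: "complex_structure M J" and F: "smooth_form M 2 F"
  defines "C \<equiv> twist F J J"
  defines "K \<equiv> \<lambda>p vs. twist F J (\<lambda>p v. v) p vs + twist F (\<lambda>p v. v) J p vs"
  shows "smooth_form M 2 C" "smooth_form M 2 K"
    and "ext_d M C p [J p u, v, w] + ext_d M C p [u, J p v, w] + ext_d M C p [u, v, J p w]
      + 3 * ext_d M C p [J p u, J p v, J p w] + 4 * ext_d M K p [u, v, w] =
      3 * (ext_d M F p [J p u, v, w] + ext_d M F p [u, J p v, w] + ext_d M F p [u, v, J p w])
      + ext_d M F p [J p u, J p v, J p w]"
proof -
  note t = smooth_form_tensor[OF F]
  note eJ = smooth_endo_complex_structure[OF J] and eI = smooth_endo_id[OF M]
  have t1: "smooth_tensor M 2 (twist F J (\<lambda>p v. v))" and t2: "smooth_tensor M 2 (twist F (\<lambda>p v. v) J)"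
    by (rule smooth_tensor_twist[OF M t] eJ eI)+
  show C: "smooth_form M 2 C" unfolding C_def
    by (rule smooth_form_2I[OF smooth_tensor_twist[OF M t eJ eJ]]) (simp add: smooth_form_diag[OF F])
  show K: "smooth_form M 2 K"
  proof (rule smooth_form_2I)
    show "smooth_tensor M 2 K" using smooth_tensor_lincomb[OF M t1 t2, of 1 1] by (simp add: K_def)
    show "K p [v, v] = 0" for p v using smooth_form_skew[OF F, of p "J p v" v] by (simp add: K_def)
  qed
  obtain c J0 where c: "smooth_atlas (insert c M)" "p \<in> fst c" and J0: "\<And>v. J0 (J0 v) = - v"
    and JJ: "\<And>q v. q \<in> fst c \<Longrightarrow> J q (from_chart M c q v) = from_chart M c q (J0 v)"
    using complex_structure_adapted_chart[OF M J] by metis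
  let ?f = "from_chart M c p" and ?t = "to_chart M c p"
  define T where "T u v w = coord_deriv M c F p u [v, w]" for u v w
  note bl = bilinear_coord_deriv[OF M c t]
  have neg: "T (- u) v w = - T u v w" "T u (- v) w = - T u v w" "T u v (- w) = - T u v w" for u v w
    using linear_neg[OF linear_coord_deriv[OF M c t]] bilinear_lneg[OF bl] bilinear_rneg[OF bl]
    by (simp_all add: T_def)
  note tw = coord_deriv_twist_const[OF M c t]
  have tC: "coord_deriv M c C p u [v, w] = T u (J0 v) (J0 w)" for u v w
    unfolding C_def T_def by (rule tw[where ?A0.0 = J0 and ?B0.0 = J0]) (rule JJ, assumption)+
  have "coord_deriv M c (twist F J (\<lambda>p v. v)) p u [v, w] = T u (J0 v) w" for u v w
    unfolding T_def by (rule tw[where ?A0.0 = J0 and ?B0.0 = "\<lambda>v. v"]) (rule JJ refl, assumption?)+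
  moreover have "coord_deriv M c (twist F (\<lambda>p v. v) J) p u [v, w] = T u v (J0 w)" for u v w
    unfolding T_def by (rule tw[where ?A0.0 = "\<lambda>v. v" and ?B0.0 = J0]) (rule JJ refl, assumption?)+
  ultimately have tK: "coord_deriv M c K p u [v, w] = T u (J0 v) w + T u v (J0 w)" for u v w
    unfolding K_def by (simp add: coord_deriv_add[OF M c t1 t2])
  have dF: "ext_d M F p [?f u, ?f v, ?f w] = T u v w - T v u w + T w u v" for u v w
    unfolding ext_d_2_chart[OF M c F] by (simp add: T_def)
  have dC: "ext_d M C p [?f u, ?f v, ?f w] = T u (J0 v) (J0 w) - T v (J0 u) (J0 w) + T w (J0 u) (J0 v)" for u v w
    unfolding ext_d_2_chart[OF M c C] by (simp add: tC)
  have dK: "ext_d M K p [?f u, ?f v, ?f w] = T u (J0 v) w + T u v (J0 w) - T v (J0 u) w - T v u (J0 w)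
      + T w (J0 u) v + T w u (J0 v)" for u v w
    unfolding ext_d_2_chart[OF M c K]
    by (simp add: tK)
  \<comment> \<open>The formulas for \<open>dF\<close>, \<open>dC\<close> and \<open>dK\<close>
    apply to images of coordinate vectors, so the given tangent vectors are written as such images.
    Then \<open>J\<close> becomes \<open>J0\<close>, and its square and the sign rules for
    \<open>T\<close> reduce the claim to linear arithmetic.\<close>
  define u' v' w' where "u' = ?t u" and "v' = ?t v" and "w' = ?t w"
  have uvw: "u = ?f u'" "v = ?f v'" "w = ?f w'"
    unfolding u'_def v'_def w'_def by (simp_all add: from_to_chart[OF M c])
  show "ext_d M C p [J p u, v, w] + ext_d M C p [u, J p v, w] + ext_d M C p [u, v, J p w]
      + 3 * ext_d M C p [J p u, J p v, J p w] + 4 * ext_d M K p [u, v, w] =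
      3 * (ext_d M F p [J p u, v, w] + ext_d M F p [u, J p v, w] + ext_d M F p [u, v, J p w])
      + ext_d M F p [J p u, J p v, J p w]"
    unfolding uvw JJ[OF c(2)] dF dC dK by (simp add: J0 neg)
qed

section \<open>Components of type (a, b)\<close>

lemma cplx_ext_zero:
  "(\<And>vs. length vs = length zs \<Longrightarrow> f vs = 0) \<Longrightarrow> cplx_ext f zs = 0"
proof (induction zs arbitrary: f)
  case (Cons z zs)
  have "cplx_ext (\<lambda>vs. f (x # vs)) zs = 0" for x
    by (rule Cons.IH) (simp add: Cons.prems)
  then show ?case unfolding cplx_ext.simps by simp
next
  case Nil
  then show ?case by simp
qed

lemma type_part_zero:
  assumes "\<And>vs. length vs = a + b \<Longrightarrow> \<alpha> p vs = 0"
  shows "type_part J a b \<alpha> p vs = 0"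
  unfolding type_part_def using assms by (auto intro!: sum.neutral cplx_ext_zero)

text \<open>\<open>cplx_ext\<close> consumes a complex vector through its real and imaginary parts,
  so these formulas for (v - i Jv)/2 and (v + i Jv)/2 are all that evaluating a type component
  requires.\<close>

lemma re_im_proj:
  assumes "linear J"
  shows "re_vec (proj10 J (cplx_vec v)) = (1/2) *\<^sub>R v"
    and "im_vec (proj10 J (cplx_vec v)) = (-1/2) *\<^sub>R J v"
    and "re_vec (proj01 J (cplx_vec v)) = (1/2) *\<^sub>R v"
    and "im_vec (proj01 J (cplx_vec v)) = (1/2) *\<^sub>R J v"
proof -
  have "re_vec (cplx_vec v) = v" "im_vec (cplx_vec v) = 0"
    by (simp_all add: vec_eq_iff re_vec_def im_vec_def cplx_vec_def)
  then have "cplx_map J (cplx_vec v) = cplx_vec (J v)"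
    using linear_0[OF assms] by (simp add: cplx_map_def) (simp add: vec_eq_iff cplx_vec_def)
  then show "re_vec (proj10 J (cplx_vec v)) = (1/2) *\<^sub>R v"
    and "im_vec (proj10 J (cplx_vec v)) = (-1/2) *\<^sub>R J v"
    and "re_vec (proj01 J (cplx_vec v)) = (1/2) *\<^sub>R v"
    and "im_vec (proj01 J (cplx_vec v)) = (1/2) *\<^sub>R J v"
    by (simp_all add: vec_eq_iff re_vec_def im_vec_def cplx_vec_def proj10_def proj01_def)
qed

lemma sum_Pow_insert:
  assumes "finite A" "x \<notin> A"
  shows "(\<Sum>S\<in>Pow (insert x A). f S) = (\<Sum>S\<in>Pow A. f S + f (insert x S))"
proof -
  have "(\<Sum>S\<in>Pow (insert x A). f S) = (\<Sum>S\<in>Pow A. f S) + (\<Sum>S\<in>insert x ` Pow A. f S)"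
    unfolding Pow_insert using assms by (intro sum.union_disjoint) auto
  moreover have "inj_on (insert x) (Pow A)"
    using assms by (auto simp: inj_on_def)
  ultimately show ?thesis by (simp add: sum.reindex sum.distrib)
qed

text \<open>With the cardinality condition moved into the summand, the sum runs over a full power
  set, which \<open>sum_Pow_insert\<close> unrolls one index at a time.\<close>

lemma type_part_sum_Pow:
  assumes "length vs = n" "a + b = n"
  shows "type_part J a b \<alpha> p vs = (\<Sum>S\<in>Pow {..<n}. if card S = a then
     cplx_ext (\<alpha> p) (map (\<lambda>i. (if i \<in> S then proj10 (J p) else proj01 (J p)) (cplx_vec (vs ! i))) [0..<n]) else 0)"
  by (subst sum.inter_filter[symmetric]) (simp_all add: type_part_def assms)

text \<open>The complex bilinear extension is evaluated on the vectors (v - i Jv)/2 and (v + i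
  Jv)/2. In type (1,1) the imaginary cross terms of the two subsets cancel; in types (2,0) and (0,2)
  they survive with opposite signs.\<close>

lemma
  fixes \<alpha> :: "('m::{t2_space,second_countable_topology}, 'n::finite, complex) tensor"
  assumes J: "linear (J p)" and \<alpha>: "smooth_tensor M 2 \<alpha>"
  shows type_part_11: "type_part J 1 1 \<alpha> p [v, w] = (\<alpha> p [v, w] + \<alpha> p [J p v, J p w]) / 2"
    and type_part_20: "type_part J 2 0 \<alpha> p [v, w] = (\<alpha> p [v, w] - \<alpha> p [J p v, J p w]
       - \<i> * (\<alpha> p [J p v, w] + \<alpha> p [v, J p w])) / 4"
    and type_part_02: "type_part J 0 2 \<alpha> p [v, w] = (\<alpha> p [v, w] - \<alpha> p [J p v, J p w]
       + \<i> * (\<alpha> p [J p v, w] + \<alpha> p [v, J p w])) / 4"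
proof -
  have 2: "{..<2} = {0, 1::nat}" "[0..<2] = [0, 1]" by (auto simp: upt_rec)
  note bl = smooth_tensor_bilinear[OF \<alpha>]
  note S = sum_Pow_insert re_im_proj[OF J]
    bilinear_lmul[OF bl] bilinear_rmul[OF bl] bilinear_lneg[OF bl] bilinear_rneg[OF bl] 2
  show "type_part J 1 1 \<alpha> p [v, w] = (\<alpha> p [v, w] + \<alpha> p [J p v, J p w]) / 2"
    by (subst type_part_sum_Pow[where n = 2]) (simp_all add: S complex_eq_iff field_simps)
  show "type_part J 2 0 \<alpha> p [v, w] = (\<alpha> p [v, w] - \<alpha> p [J p v, J p w]
       - \<i> * (\<alpha> p [J p v, w] + \<alpha> p [v, J p w])) / 4"
    by (subst type_part_sum_Pow[where n = 2]) (simp_all add: S complex_eq_iff field_simps)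
  show "type_part J 0 2 \<alpha> p [v, w] = (\<alpha> p [v, w] - \<alpha> p [J p v, J p w]
       + \<i> * (\<alpha> p [J p v, w] + \<alpha> p [v, J p w])) / 4"
    by (subst type_part_sum_Pow[where n = 2]) (simp_all add: S complex_eq_iff field_simps)
qed

section \<open>Type components of 3-forms and the forms defining Courant algebroids\<close>

lemma smooth_tensor_trilinear:
  assumes "smooth_tensor M 3 \<alpha>"
  shows "linear (\<lambda>u. \<alpha> p [u, v, w])" "linear (\<lambda>u. \<alpha> p [v, u, w])" "linear (\<lambda>u. \<alpha> p [v, w, u])"
proof -
  have l: "linear (\<lambda>u. \<alpha> p (vs[i := u]))" if "length vs = 3" "i < 3" for vs i
    using assms that unfolding smooth_tensor_def by blast
  show "linear (\<lambda>u. \<alpha> p [u, v, w])" "linear (\<lambda>u. \<alpha> p [v, u, w])" "linear (\<lambda>u. \<alpha> p [v, w, u])"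
    using l[of "[0, v, w]" 0] l[of "[v, 0, w]" 1] l[of "[v, w, 0]" 2] by simp_all
qed

text \<open>A slot projected to (1,0) or (0,1) carries \<open>J\<close> with factor -i or i. Adding
  these sign products over the subsets of the required size gives the coefficients: three subsets
  for the mixed types, a single one for (3,0).\<close>

lemma
  fixes \<alpha> :: "('m::{t2_space,second_countable_topology}, 'n::finite, complex) tensor"
  assumes J: "linear (J p)" and \<alpha>: "smooth_tensor M 3 \<alpha>"
  defines "D u v w \<equiv> \<alpha> p [J p u, v, w] + \<alpha> p [u, J p v, w] + \<alpha> p [u, v, J p w]"
    and "E u v w \<equiv> \<alpha> p [J p u, J p v, w] + \<alpha> p [J p u, v, J p w] + \<alpha> p [u, J p v, J p w]"
  shows type_part_21: "type_part J 2 1 \<alpha> p [u, v, w] = (3 * \<alpha> p [u, v, w] - \<i> * D u v w + E u v w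
       - 3 * \<i> * \<alpha> p [J p u, J p v, J p w]) / 8"
    and type_part_12: "type_part J 1 2 \<alpha> p [u, v, w] = (3 * \<alpha> p [u, v, w] + \<i> * D u v w + E u v w
       + 3 * \<i> * \<alpha> p [J p u, J p v, J p w]) / 8"
    and type_part_30: "type_part J 3 0 \<alpha> p [u, v, w] = (\<alpha> p [u, v, w] - \<i> * D u v w - E u v w
       + \<i> * \<alpha> p [J p u, J p v, J p w]) / 8"
proof -
  have 3: "{..<3} = {0, 1, 2::nat}" "[0..<3] = [0, 1, 2]" by (auto simp: upt_rec)
  note lin = smooth_tensor_trilinear[OF \<alpha>]
  note S = sum_Pow_insert re_im_proj[OF J]
    linear_scale[OF lin(1)] linear_scale[OF lin(2)] linear_scale[OF lin(3)]
    linear_neg[OF lin(1)] linear_neg[OF lin(2)] linear_neg[OF lin(3)] 3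
  show "type_part J 2 1 \<alpha> p [u, v, w] = (3 * \<alpha> p [u, v, w] - \<i> * D u v w + E u v w
       - 3 * \<i> * \<alpha> p [J p u, J p v, J p w]) / 8"
    by (subst type_part_sum_Pow[where n = 3]) (simp_all add: S D_def E_def complex_eq_iff field_simps)
  show "type_part J 1 2 \<alpha> p [u, v, w] = (3 * \<alpha> p [u, v, w] + \<i> * D u v w + E u v w
       + 3 * \<i> * \<alpha> p [J p u, J p v, J p w]) / 8"
    by (subst type_part_sum_Pow[where n = 3]) (simp_all add: S D_def E_def complex_eq_iff field_simps)
  show "type_part J 3 0 \<alpha> p [u, v, w] = (\<alpha> p [u, v, w] - \<i> * D u v w - E u v w
       + \<i> * \<alpha> p [J p u, J p v, J p w]) / 8"
    by (subst type_part_sum_Pow[where n = 3]) (simp_all add: S D_def E_def complex_eq_iff field_simps)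
qed

lemma courant_form_components:
  assumes "courant_form M J P"
  obtains P21 P30 where "smooth_form M 3 P21" "type_part J 2 1 P21 = P21"
    "smooth_form M 3 P30" "type_part J 3 0 P30 = P30" "P = (\<lambda>p vs. P21 p vs + P30 p vs)"
proof -
  from assms obtain P21 P30 where "form_of_type M J 2 1 P21" "form_of_type M J 3 0 P30"
    "P = (\<lambda>p vs. P21 p vs + P30 p vs)"
    unfolding courant_form_def by blast
  then show thesis by (intro that[of P21 P30]) (auto simp: form_of_type_def)
qed

lemma courant_form_smooth:
  assumes "smooth_atlas M" "courant_form M J P"
  shows "smooth_form M 3 P"
proof -
  obtain P21 P30 where P: "smooth_form M 3 P21" "smooth_form M 3 P30" "P = (\<lambda>p vs. P21 p vs + P30 p vs)"
    using courant_form_components[OF assms(2)] by blast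
  show ?thesis using smooth_form_lincomb[OF assms(1) P(1,2), of 1 1] by (simp add: P(3))
qed

text \<open>The derivation extending \<open>J\<close> acts on types (2,1) and (3,0) as \<open>\<i>\<close> and \<open>3\<i>\<close>, and the
  pullback by \<open>J\<close> as \<open>\<i>\<close> and \<open>-\<i>\<close>: their sum is \<open>2\<i>\<close> in both cases.\<close>

lemma courant_form_eigen:
  fixes M :: "('m::{t2_space,second_countable_topology}, 'n::finite) atlas"
  assumes J: "complex_structure M J" and P: "courant_form M J P"
  shows "P p [J p u, v, w] + P p [u, J p v, w] + P p [u, v, J p w] + P p [J p u, J p v, J p w]
    = 2 * \<i> * P p [u, v, w]"
proof -
  obtain P21 P30 where P21: "smooth_form M 3 P21" "type_part J 2 1 P21 = P21"
    and P30: "smooth_form M 3 P30" "type_part J 3 0 P30 = P30" and P: "P = (\<lambda>p vs. P21 p vs + P30 p vs)"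
    by (rule courant_form_components[OF P])
  note l = complex_structure_linear[OF J, of p]
  note sq = complex_structure_square[OF J]
  define f where "f u v w = P21 p [u, v, w]" for u v w
  define g where "g u v w = P30 p [u, v, w]" for u v w
  have neg: "f (- u) v w = - f u v w" "f u (- v) w = - f u v w" "f u v (- w) = - f u v w"
    "g (- u) v w = - g u v w" "g u (- v) w = - g u v w" "g u v (- w) = - g u v w" for u v w
    using smooth_tensor_trilinear[OF smooth_form_tensor[OF P21(1)], THEN linear_neg]
      smooth_tensor_trilinear[OF smooth_form_tensor[OF P30(1)], THEN linear_neg]
    by (simp_all add: f_def g_def)
  have f: "8 * f u v w = 3 * f u v w - \<i> * (f (J p u) v w + f u (J p v) w + f u v (J p w))
    + (f (J p u) (J p v) w + f (J p u) v (J p w) + f u (J p v) (J p w)) - 3 * \<i> * f (J p u) (J p v) (J p w)" for u v w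
    using type_part_21[where J = J, OF l smooth_form_tensor[OF P21(1)], of u v w] unfolding P21(2) f_def by simp
  have g: "8 * g u v w = g u v w - \<i> * (g (J p u) v w + g u (J p v) w + g u v (J p w))
    - (g (J p u) (J p v) w + g (J p u) v (J p w) + g u (J p v) (J p w)) + \<i> * g (J p u) (J p v) (J p w)" for u v w
    using type_part_30[where J = J, OF l smooth_form_tensor[OF P30(1)], of u v w] unfolding P30(2) g_def by simp
  let ?J = "J p"
  \<comment> \<open>Being of pure type is a linear relation among the eight values obtained by
    inserting \<open>J\<close> into any set of slots. Applying it with \<open>J\<close> already
    inserted gives eight equations, whose real and imaginary parts determine the
    eigenvalues.\<close>
  have "f (?J u) v w + f u (?J v) w + f u v (?J w) = \<i> * f u v w" "f (?J u) (?J v) (?J w) = \<i> * f u v w"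
    using f[of u v w] f[of "?J u" v w] f[of u "?J v" w] f[of u v "?J w"]
      f[of "?J u" "?J v" w] f[of "?J u" v "?J w"] f[of u "?J v" "?J w"] f[of "?J u" "?J v" "?J w"]
    unfolding sq neg complex_eq_iff by (simp_all; linarith)+
  moreover have "g (?J u) v w + g u (?J v) w + g u v (?J w) = 3 * \<i> * g u v w" "g (?J u) (?J v) (?J w) = - \<i> * g u v w"
    using g[of u v w] g[of "?J u" v w] g[of u "?J v" w] g[of u v "?J w"]
      g[of "?J u" "?J v" w] g[of "?J u" v "?J w"] g[of u "?J v" "?J w"] g[of "?J u" "?J v" "?J w"]
    unfolding sq neg complex_eq_iff by (simp_all; linarith)+
  ultimately show ?thesis
    unfolding P f_def g_def by (simp add: algebra_simps)
qed

section \<open>The operator d\<open>\<^sup>c\<close> on real forms of type (1,1)\<close>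

text \<open>The summands with a factor i in the (2,0) and (0,2) components of a real form are
  opposite, so their sum is real. For lists of other lengths both sides vanish.\<close>

lemma
  fixes F :: "('m::{t2_space,second_countable_topology}, 'n::finite, real) tensor"
  assumes M: "smooth_atlas M" and J: "linear (J p)" and F: "smooth_tensor M 2 F"
  shows type_part_real_11: "type_part J 1 1 (of_real_form F) p vs
      = of_real_form (\<lambda>p vs. (F p vs + conjugate_by J F p vs) / 2) p vs"
    and type_part_real_20_02: "type_part J 2 0 (of_real_form F) p vs + type_part J 0 2 (of_real_form F) p vs
      = of_real_form (\<lambda>p vs. (F p vs - conjugate_by J F p vs) / 2) p vs"
proof -
  have C: "smooth_tensor M 2 (of_real_form F)"
    unfolding of_real_form_def by (rule smooth_tensor_bounded_linear[OF M bounded_linear_of_real F])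
  have *: "type_part J 1 1 (of_real_form F) p vs = of_real_form (\<lambda>p vs. (F p vs + conjugate_by J F p vs) / 2) p vs
    \<and> type_part J 2 0 (of_real_form F) p vs + type_part J 0 2 (of_real_form F) p vs
      = of_real_form (\<lambda>p vs. (F p vs - conjugate_by J F p vs) / 2) p vs"
  proof (cases "length vs = 2")
    case True
    then obtain v w where "vs = [v, w]" by (rule length_2E)
    then show ?thesis
      by (simp add: type_part_11[where J = J, OF J C, unfolded One_nat_def] type_part_20[where J = J, OF J C] type_part_02[where J = J, OF J C])
         (simp add: of_real_form_def conjugate_by_def field_simps)
  next
    case False
    then show ?thesis
      using smooth_tensor_length[OF F]
      by (simp add: type_part_def of_real_form_def conjugate_by_def)
  qed
  then show "type_part J 1 1 (of_real_form F) p vs = of_real_form (\<lambda>p vs. (F p vs + conjugate_by J F p vs) / 2) p vs"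
    and "type_part J 2 0 (of_real_form F) p vs + type_part J 0 2 (of_real_form F) p vs
      = of_real_form (\<lambda>p vs. (F p vs - conjugate_by J F p vs) / 2) p vs" by auto
qed

text \<open>Invariance under \<open>J\<close> means type (1,1), so \<open>del\<close> and
  \<open>delbar\<close> are the (2,1) and (1,2) components of d\<omega>. In their difference the
  terms with zero or two copies of \<open>J\<close> cancel, which leaves the weights 1 and 3 over
  4.\<close>

lemma
  fixes \<omega> :: "('m::{t2_space,second_countable_topology}, 'n::finite, real) tensor"
  assumes M: "smooth_atlas M" and J: "complex_structure M J" and \<omega>: "smooth_form M 2 \<omega>"
    and inv: "\<And>p v w. \<omega> p [J p v, J p w] = \<omega> p [v, w]"
  shows d_c_11: "d_c M J (of_real_form \<omega>) p [u, v, w] = of_real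
      (- (ext_d M \<omega> p [J p u, v, w] + ext_d M \<omega> p [u, J p v, w] + ext_d M \<omega> p [u, v, J p w]
         + 3 * ext_d M \<omega> p [J p u, J p v, J p w]) / 4)"
    and d_c_11_length: "length vs \<noteq> 3 \<Longrightarrow> d_c M J (of_real_form \<omega>) p vs = 0"
proof -
  note t = smooth_form_tensor[OF \<omega>]
  have C: "smooth_form M 2 (of_real_form \<omega>)"
    using smooth_form_bounded_linear[OF M bounded_linear_of_real \<omega>] by (simp add: of_real_form_def)
  have zero: "type_part J a b (of_real_form \<omega>) = (\<lambda>p vs. 0)" if "a + b \<noteq> 2" for a b
    using smooth_form_length[OF C] that by (intro ext type_part_zero) auto
  have zero': "type_part J a b (\<lambda>p vs. 0) p vs = 0" for a b p vs
    by (rule type_part_zero) simp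
  have d0: "ext_d M (\<lambda>p vs. 0 :: complex) = (\<lambda>p vs. 0)" by (intro ext) (rule ext_d_zero)
  \<comment> \<open>Invariance applied to \<open>v\<close> and \<open>J w\<close>; this removes the
    imaginary parts of the (2,0) and (0,2) components.\<close>
  have anti: "\<omega> p [J p v, w] = - \<omega> p [v, J p w]" for p v w
    using inv[of p "v" "J p w"] complex_structure_square[OF J] bilinear_rneg[OF smooth_tensor_bilinear[OF t]] by simp
  note l = complex_structure_linear[OF J]
  have z: "type_part J 2 0 (of_real_form \<omega>) = (\<lambda>p vs. 0)" "type_part J 0 2 (of_real_form \<omega>) = (\<lambda>p vs. 0)"
    "type_part J 1 1 (of_real_form \<omega>) = of_real_form \<omega>"
  proof -
    have "type_part J 2 0 (of_real_form \<omega>) p vs = 0 \<and> type_part J 0 2 (of_real_form \<omega>) p vs = 0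
      \<and> type_part J 1 1 (of_real_form \<omega>) p vs = of_real_form \<omega> p vs" for p vs
    proof (cases "length vs = 2")
      case True
      then obtain v w where "vs = [v, w]" by (rule length_2E)
      then show ?thesis
        by (simp add: type_part_11[where J = J, OF l smooth_form_tensor[OF C], unfolded One_nat_def] type_part_20[where J = J, OF l smooth_form_tensor[OF C]] type_part_02[where J = J, OF l smooth_form_tensor[OF C]])
           (simp add: of_real_form_def inv anti[of p v w])
    next
      case False
      then show ?thesis using smooth_form_length[OF C] by (simp add: type_part_def)
    qed
    then show "type_part J 2 0 (of_real_form \<omega>) = (\<lambda>p vs. 0)" "type_part J 0 2 (of_real_form \<omega>) = (\<lambda>p vs. 0)"
      "type_part J 1 1 (of_real_form \<omega>) = of_real_form \<omega>" by (auto intro!: ext)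
  qed
  show "d_c M J (of_real_form \<omega>) p vs = 0" if "length vs \<noteq> 3"
  proof -
    have "a + (length vs - 1 - a) \<noteq> 2" if "a < length vs" for a
      using that \<open>length vs \<noteq> 3\<close> by auto
    then show ?thesis
      unfolding d_c_def del_def delbar_def Let_def by (simp add: zero d0 zero')
  qed
  define \<Omega> where "\<Omega> = ext_d M (of_real_form \<omega>)"
  have dC: "\<Omega> p vs = of_real (ext_d M \<omega> p vs)" for p vs
    unfolding \<Omega>_def using ext_d_bounded_linear[OF M bounded_linear_of_real t] by (simp add: of_real_form_def)
  have s: "smooth_tensor M 3 \<Omega>"
    unfolding \<Omega>_def by (rule smooth_form_tensor[OF smooth_form_ext_d[OF M C]])
  \<comment> \<open>Among the summands \<open>a = 0, 1, 2\<close> of \<open>del\<close> and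
    \<open>delbar\<close> only \<open>a = 1\<close> starts from a nonzero component.\<close>
  have "d_c M J (of_real_form \<omega>) p [u, v, w] = \<i> * (type_part J 1 2 \<Omega> p [u, v, w] - type_part J 2 1 \<Omega> p [u, v, w])"
    unfolding d_c_def del_def delbar_def Let_def \<Omega>_def
    by (simp add: numeral_3_eq_3 z[unfolded numeral_2_eq_2 One_nat_def] d0 zero' numeral_2_eq_2)
  then show "d_c M J (of_real_form \<omega>) p [u, v, w] = of_real
      (- (ext_d M \<omega> p [J p u, v, w] + ext_d M \<omega> p [u, J p v, w] + ext_d M \<omega> p [u, v, J p w]
         + 3 * ext_d M \<omega> p [J p u, J p v, J p w]) / 4)"
    unfolding type_part_12[where J = J, OF l s] type_part_21[where J = J, OF l s] dC
    by (simp add: complex_eq_iff field_simps)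
qed

section \<open>The form F and its parts\<close>

lemma conjugate_by_twist: "smooth_tensor M 2 F \<Longrightarrow> conjugate_by J F = twist F J J"
  by (intro ext) (auto simp: conjugate_by_def twist_def smooth_tensor_length elim!: length_2E)

lemma precomp_twist:
  assumes "smooth_tensor M 2 F"
  shows "precomp F J = twist F J (\<lambda>p v. v)"
proof (intro ext)
  show "precomp F J p vs = twist F J (\<lambda>p v. v) p vs" for p vs
  proof (cases "length vs = 2")
    case True
    then show ?thesis by (auto simp: precomp_def elim: length_2E)
  next
    case False
    then show ?thesis
      using smooth_tensor_length[OF assms] by (cases vs) (simp_all add: precomp_def twist_def)
  qed
qed

text \<open>One structure is treated at a time; the sign \<open>s\<close> is 1 for
  \<open>I\<^sub>p\<close> and -1 for \<open>I\<^sub>m\<close>.\<close>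

lemma
  fixes F :: "('m::{t2_space,second_countable_topology}, 'n::finite, real) tensor"
  assumes M: "smooth_atlas M" and J: "complex_structure M J" and F: "smooth_form M 2 F"
  defines "\<omega> \<equiv> \<lambda>p vs. (F p vs + conjugate_by J F p vs) / 2"
    and "\<beta> \<equiv> \<lambda>p vs. (F p vs - conjugate_by J F p vs) / 2"
    and "g \<equiv> sym_part (\<lambda>p vs. - precomp F J p vs)"
    and "b \<equiv> skew_part (\<lambda>p vs. - precomp F J p vs)"
  shows sym_part_precomp: "g = (\<lambda>p vs. - precomp \<omega> J p vs)"
    and skew_part_precomp: "b = (\<lambda>p vs. - precomp \<beta> J p vs)"
    and precomp_sym_part: "precomp g J = \<omega>"
    and sym_part_invariant: "g p [J p v, J p w] = g p [v, w]"
    and smooth_tensor_sym_part: "smooth_tensor M 2 g"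
    and smooth_form_skew_part: "smooth_form M 2 b"
    and d_c_form_11: "\<lbrakk>courant_form M J P; \<And>p vs. ext_d M F p vs = - s * Im (P p vs)\<rbrakk> \<Longrightarrow>
      d_c M J (of_real_form \<omega>) = of_real_form (\<lambda>p vs. s * Re (P p vs) - ext_d M b p vs)"
proof -
  note t = smooth_form_tensor[OF F]
  note sq = complex_structure_square[OF J]
  note neg = bilinear_lneg[OF smooth_tensor_bilinear[OF t]] bilinear_rneg[OF smooth_tensor_bilinear[OF t]]
  define C where "C = twist F J J"
  define K where "K = (\<lambda>p vs. twist F J (\<lambda>p v. v) p vs + twist F (\<lambda>p v. v) J p vs)"
  note CK = ext_d_twist_identity[OF M J F, folded C_def K_def]
  have F0: "F p vs = 0" if "length vs \<noteq> 2" for p vs using smooth_form_length[OF F that] .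
  have len2: "\<alpha> = \<beta>" if "\<And>p v w. \<alpha> p [v, w] = \<beta> p [v, w]"
    "\<And>p vs. length vs \<noteq> 2 \<Longrightarrow> \<alpha> p vs = 0" "\<And>p vs. length vs \<noteq> 2 \<Longrightarrow> \<beta> p vs = 0"
    for \<alpha> \<beta> :: "('m, 'n, real) tensor"
  proof (intro ext)
    show "\<alpha> p vs = \<beta> p vs" for p vs
      using that by (cases "length vs = 2") (auto elim: length_2E)
  qed
  have C: "\<omega> = (\<lambda>p vs. (1/2) *\<^sub>R F p vs + (1/2) *\<^sub>R C p vs)"
    unfolding \<omega>_def C_def conjugate_by_twist[OF t] by (simp add: add_divide_distrib)
  have pre0: "precomp F J p vs = 0" if "length vs \<noteq> 2" for p vs
    using that by (simp add: precomp_twist[OF t] twist_def)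
  have pre2: "precomp F J p [v, w] = F p [J p v, w]" for p v w by (simp add: precomp_def)
  \<comment> \<open>Skew-symmetry of \<open>F\<close> rewrites -F(Jw, v) as F(v, Jw), so the skew
    part of -FJ is minus half the derivation action of \<open>J\<close> on \<open>F\<close>.\<close>
  have K: "b = (\<lambda>p vs. (-1/2) *\<^sub>R K p vs)"
  proof (rule len2)
    show "b p [v, w] = (-1/2) *\<^sub>R K p [v, w]" for p v w
      using smooth_form_skew[OF F, of p "J p w" v]
      by (simp add: b_def skew_part_def pre2 K_def add_divide_distrib diff_divide_distrib)
  qed (simp_all add: b_def skew_part_def pre0 K_def twist_def)
  have prc0: "precomp \<alpha> J p vs = 0" if "\<And>p vs. length vs \<noteq> 2 \<Longrightarrow> \<alpha> p vs = 0" "length vs \<noteq> 2"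
    for \<alpha> :: "('m, 'n, real) tensor" and p vs
    using that by (auto simp: precomp_def split: list.split)
  have \<omega>0: "\<omega> p vs = 0" if "length vs \<noteq> 2" for p vs
    using that by (simp add: \<omega>_def F0 conjugate_by_def)
  have \<beta>0: "\<beta> p vs = 0" if "length vs \<noteq> 2" for p vs
    using that by (simp add: \<beta>_def F0 conjugate_by_def)
  have g0: "g p vs = 0" if "length vs \<noteq> 2" for p vs
    using that by (simp add: g_def sym_part_def pre0)
  have b0: "b p vs = 0" if "length vs \<noteq> 2" for p vs
    using that by (simp add: b_def skew_part_def pre0)
  have g2: "g p [v, w] = - (F p [J p v, w] + F p [J p w, v]) / 2" for p v w
    by (simp add: g_def sym_part_def pre2)
  have b2: "b p [v, w] = - (F p [J p v, w] - F p [J p w, v]) / 2" for p v w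
    by (simp add: b_def skew_part_def pre2)
  have sk: "F p [v, J p w] = - F p [J p w, v]" for p v w using smooth_form_skew[OF F] .
  show "g = (\<lambda>p vs. - precomp \<omega> J p vs)"
    by (rule len2) (simp_all add: g0 prc0 \<omega>0 g2, simp add: precomp_def \<omega>_def conjugate_by_def sq neg sk add_divide_distrib diff_divide_distrib)
  show "b = (\<lambda>p vs. - precomp \<beta> J p vs)"
    by (rule len2) (simp_all add: b0 prc0 \<beta>0 b2, simp add: precomp_def \<beta>_def conjugate_by_def sq neg sk add_divide_distrib diff_divide_distrib)
  show "precomp g J = \<omega>"
  proof (rule len2)
    show "precomp g J p [v, w] = \<omega> p [v, w]" for p v w
      using smooth_form_skew[OF F, of p "J p w" "J p v"]
      by (simp add: precomp_def \<omega>_def conjugate_by_def sq neg g2)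
  qed (simp_all add: g0 prc0 \<omega>0)
  show "g p [J p v, J p w] = g p [v, w]"
    by (simp add: g2 sq neg sk)
  have inv: "\<omega> p [J p v, J p w] = \<omega> p [v, w]" for p v w
    by (simp add: \<omega>_def conjugate_by_def sq neg)
  show "smooth_tensor M 2 g"
  proof -
    have s: "smooth_tensor M 2 (precomp F J)"
      unfolding precomp_twist[OF t]
      by (rule smooth_tensor_twist[OF M t smooth_endo_complex_structure[OF J] smooth_endo_id[OF M]])
    have *: "g = (\<lambda>p vs. (-1/2) *\<^sub>R precomp F J p vs + (-1/2) *\<^sub>R precomp F J p (rev vs))"
      by (intro ext) (simp add: g_def sym_part_def field_simps)
    show ?thesis unfolding * by (rule smooth_tensor_lincomb[OF M s smooth_tensor_rev[OF s]])
  qed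
  show "smooth_form M 2 b"
    unfolding K using smooth_form_bounded_linear[OF M bounded_linear_scaleR_right CK(2)] .
  have \<omega>: "smooth_form M 2 \<omega>"
    unfolding C by (rule smooth_form_lincomb[OF M F CK(1)])
  assume P: "courant_form M J P" and dF: "\<And>p vs. ext_d M F p vs = - s * Im (P p vs)"
  have d\<omega>: "ext_d M \<omega> p vs = (ext_d M F p vs + ext_d M C p vs) / 2" for p vs
    unfolding C ext_d_lincomb[OF M t smooth_form_tensor[OF CK(1)]] by simp
  have db: "ext_d M b p vs = - ext_d M K p vs / 2" for p vs
    unfolding K ext_d_bounded_linear[OF M bounded_linear_scaleR_right smooth_form_tensor[OF CK(2)]] by simp
  have "d_c M J (of_real_form \<omega>) p vs = of_real_form (\<lambda>p vs. s * Re (P p vs) - ext_d M b p vs) p vs" for p vs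
  proof (cases "length vs = 3")
    case True
    then obtain u v w where vs: "vs = [u, v, w]" by (rule length_3E)
    have "Im (P p [J p u, v, w] + P p [u, J p v, w] + P p [u, v, J p w] + P p [J p u, J p v, J p w])
      = 2 * Re (P p [u, v, w])"
      by (simp add: courant_form_eigen[OF J P])
    then have "s * (Im (P p [J p u, v, w]) + Im (P p [u, J p v, w]) + Im (P p [u, v, J p w]) + Im (P p [J p u, J p v, J p w]))
      = s * (2 * Re (P p [u, v, w]))" by simp
    then have "ext_d M F p [J p u, v, w] + ext_d M F p [u, J p v, w] + ext_d M F p [u, v, J p w]
        + ext_d M F p [J p u, J p v, J p w] = - 2 * (s * Re (P p [u, v, w]))"
      unfolding dF by (simp add: algebra_simps)
    \<comment> \<open>The formula for d^c is applied to d\<omega> = (dF + dC)/2. The twist identity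
      trades the terms in dC for dF and dK; the terms in dF sum to the multiple of Re P just found,
      and those in dK to -db.\<close>
    then show ?thesis
      using CK(3)[of p u v w] unfolding vs d_c_11[OF M J \<omega> inv]
      unfolding of_real_form_def of_real_eq_iff d\<omega> db
      by (simp add: field_simps)
  next
    case False
    then have "P p vs = 0" using smooth_form_length[OF courant_form_smooth[OF M P]] by simp
    moreover have "ext_d M b p vs = 0"
      unfolding db using ext_d_length[OF smooth_form_tensor[OF CK(2)]] False by simp
    ultimately show ?thesis
      unfolding of_real_form_def using d_c_11_length[OF M J \<omega> inv False, unfolded of_real_form_def] by simp
  qed
  then show "d_c M J (of_real_form \<omega>) = of_real_form (\<lambda>p vs. s * Re (P p vs) - ext_d M b p vs)"
    by (intro ext)
qed

section \<open>Matched pairs\<close>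

lemma
  shows re_vec_cplx: "re_vec (cplx_vec v + \<i> *s cplx_vec w) = v"
    and im_vec_cplx: "im_vec (cplx_vec v + \<i> *s cplx_vec w) = w"
  by (simp_all add: vec_eq_iff re_vec_def im_vec_def cplx_vec_def)

lemma T01_cplx:
  assumes "linear J" "\<And>v. J (J v) = - v"
  shows "cplx_vec v + \<i> *s cplx_vec (J v) \<in> T01 J"
proof -
  have "cplx_map J (cplx_vec v + \<i> *s cplx_vec (J v)) = cplx_vec (J v) + \<i> *s cplx_vec (- v)"
    unfolding cplx_map_def re_vec_cplx im_vec_cplx assms(2) ..
  also have "\<dots> = - (\<i> *s (cplx_vec v + \<i> *s cplx_vec (J v)))"
    by (simp add: vec_eq_iff cplx_vec_def algebra_simps flip: mult.assoc)
  finally show ?thesis by (simp add: T01_def)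
qed

lemma cpair_covec_of_form:
  assumes "linear (\<lambda>v. a [v])"
  shows "cpair (covec_of_form a) Z = a [re_vec Z] + \<i> * a [im_vec Z]"
proof -
  have expand: "a [v] = (\<Sum>i\<in>UNIV. v $ i *\<^sub>R a [axis i 1])" for v
  proof -
    have "a [v] = a [\<Sum>i\<in>UNIV. v $ i *\<^sub>R axis i 1]"
      by (simp add: basis_expansion flip: scalar_mult_eq_scaleR)
    also have "\<dots> = (\<Sum>i\<in>UNIV. v $ i *\<^sub>R a [axis i 1])"
      by (simp add: linear_sum[OF assms] linear_scale[OF assms])
    finally show ?thesis .
  qed
  have "cpair (covec_of_form a) Z = (\<Sum>i\<in>UNIV. re_vec Z $ i *\<^sub>R a [axis i 1] + \<i> * (im_vec Z $ i *\<^sub>R a [axis i 1]))"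
    unfolding cpair_def covec_of_form_def
    by (intro sum.cong) (auto simp: re_vec_def im_vec_def complex_eq_iff algebra_simps)
  also have "\<dots> = a [re_vec Z] + \<i> * a [im_vec Z]"
    by (simp add: sum.distrib sum_distrib_left expand[of "re_vec Z"] expand[of "im_vec Z"])
  finally show ?thesis .
qed

text \<open>The complex bilinear extension of iF, with real and imaginary parts separated. Both
  matching conditions are read off from its real part.\<close>

lemma cpair_contract_imag_form:
  fixes F :: "('m::{t2_space,second_countable_topology}, 'n::finite, real) tensor"
  assumes "smooth_form M 2 F"
  shows "cpair (covec_of_form (contract (cplx_vec x + \<i> *s cplx_vec x') (imag_form F p))) (cplx_vec y + \<i> *s cplx_vec y')
    = \<i> * (F p [x, y] - F p [x', y']) - (F p [x', y] + F p [x, y'])"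
proof -
  note bl = smooth_tensor_bilinear[OF smooth_form_tensor[OF assms], of p]
  have c: "contract (cplx_vec x + \<i> *s cplx_vec x') (imag_form F p) [y] = \<i> * F p [x, y] - F p [x', y]" for y
  proof -
    have "re_vec (cplx_vec y) = y" "im_vec (cplx_vec y) = 0"
      by (simp_all add: vec_eq_iff re_vec_def im_vec_def cplx_vec_def)
    then show ?thesis
      by (simp add: contract_def re_vec_cplx im_vec_cplx imag_form_def bilinear_rzero[OF bl])
  qed
  have l: "linear (\<lambda>y. contract (cplx_vec x + \<i> *s cplx_vec x') (imag_form F p) [y])"
    unfolding c by (rule linearI)
      (simp_all add: bilinear_radd[OF bl] bilinear_rmul[OF bl] complex_eq_iff right_diff_distrib)
  show ?thesis
    unfolding cpair_covec_of_form[OF l] re_vec_cplx im_vec_cplx c by (simp add: algebra_simps)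
qed

lemma T01_subset_matched_pair:
  "holomorphic_Dirac M J H A \<Longrightarrow> Z \<in> T01 (J p) \<Longrightarrow> (Z, 0) \<in> matched_pair J A p"
proof -
  assume A: "holomorphic_Dirac M J H A" and Z: "Z \<in> T01 (J p)"
  have "gvec.subspace (A p)" using A by (simp add: holomorphic_Dirac_def maximal_isotropic_def)
  then have "0 \<in> A p" by (rule gvec.subspace_0)
  moreover have "(Z, 0) = 0 + (Z, 0 :: complex^'b)" by simp
  ultimately show ?thesis using Z unfolding matched_pair_def by blast
qed

text \<open>The summand from T01 has zero covector part, so the covector comes from the Dirac
  structure inside \<open>gT10 (J p)\<close> and annihilates T01.\<close>

lemma cpair_matched_pair:
  assumes "holomorphic_Dirac M J H A" "u \<in> matched_pair J A p" "Z \<in> T01 (J p)"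
  shows "cpair (snd u) Z = 0"
proof -
  obtain a Z' where "u = a + (Z', 0)" "a \<in> A p" using assms(2) unfolding matched_pair_def by blast
  moreover from this have "a \<in> gT10 (J p)"
    using assms(1) unfolding holomorphic_Dirac_def maximal_isotropic_def by blast
  ultimately show ?thesis using assms(3) by (auto simp: gT10_def coT10_def)
qed

text \<open>For Z = v + i Jv the element (Z, 0) lies in the left-hand matched pair, and its preimage
  under \<open>exp_B\<close> is (Z, -iF(Z)). That covector must annihilate w + i J'w; the real part
  of this condition is the claim.\<close>

lemma matched_pair_exp_B:
  fixes F :: "('m::{t2_space,second_countable_topology}, 'n::finite, real) tensor"
  assumes J: "complex_structure M J" and J': "complex_structure M J'"
    and A: "holomorphic_Dirac M J H A" and A': "holomorphic_Dirac M J' H' A'"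
    and F: "smooth_form M 2 F"
    and eq: "matched_pair J A p = exp_B (imag_form F p) ` matched_pair J' A' p"
  shows "F p [J p v, w] = - F p [v, J' p w]"
proof -
  let ?Z = "cplx_vec v + \<i> *s cplx_vec (J p v)" and ?W = "cplx_vec w + \<i> *s cplx_vec (J' p w)"
  have Z: "?Z \<in> T01 (J p)" "?W \<in> T01 (J' p)"
    using T01_cplx complex_structure_linear complex_structure_square J J' by blast+
  from T01_subset_matched_pair[of M J H A, OF A Z(1)] obtain u
    where u: "u \<in> matched_pair J' A' p" "(?Z, 0) = exp_B (imag_form F p) u"
    unfolding eq by blast
  then have "0 = snd u + covec_of_form (contract ?Z (imag_form F p))" by (simp add: exp_B_def prod_eq_iff)
  then have "snd u = - covec_of_form (contract ?Z (imag_form F p))" by (simp add: eq_neg_iff_add_eq_0)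
  moreover have "cpair (- \<xi>) ?W = - cpair \<xi> ?W" for \<xi> by (simp add: cpair_def sum_negf)
  ultimately have "cpair (covec_of_form (contract ?Z (imag_form F p))) ?W = 0"
    using cpair_matched_pair[of M J' H' A', OF A' u(1) Z(2)] by simp
  then show ?thesis unfolding cpair_contract_imag_form[OF F] by (simp add: complex_eq_iff)
qed

lemma matched_pair_gconj_exp_B:
  fixes F :: "('m::{t2_space,second_countable_topology}, 'n::finite, real) tensor"
  assumes J: "complex_structure M J" and J': "complex_structure M J'"
    and B: "holomorphic_Dirac M J H B" and B': "holomorphic_Dirac M J' H' B'"
    and F: "smooth_form M 2 F"
    and eq: "gconj ` matched_pair J' B' p = exp_B (imag_form F p) ` matched_pair J B p"
  shows "F p [J p v, w] = F p [v, J' p w]"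
proof -
  let ?Z = "cplx_vec v + \<i> *s cplx_vec (J p v)" and ?W = "cplx_vec w + \<i> *s cplx_vec (J' p w)"
  \<comment> \<open>Conjugation replaces the annihilated vectors of type (0,1) for \<open>J'\<close>
    by those of type (1,0), hence \<open>J'\<close> by its negative. This accounts for the sign
    opposite to that of the unconjugated case.\<close>
  let ?W' = "cplx_vec w + \<i> *s cplx_vec (- J' p w)"
  have Z: "?Z \<in> T01 (J p)" "?W \<in> T01 (J' p)"
    using T01_cplx complex_structure_linear complex_structure_square J J' by blast+
  from T01_subset_matched_pair[of M J H B, OF B Z(1)] have "exp_B (imag_form F p) (?Z, 0) \<in> gconj ` matched_pair J' B' p"
    unfolding eq by blast
  then obtain u where u: "u \<in> matched_pair J' B' p" "exp_B (imag_form F p) (?Z, 0) = gconj u" by blast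
  have "cpair (cnj_vec \<xi>) ?W' = cnj (cpair \<xi> ?W)" for \<xi>
    by (simp add: cpair_def cnj_vec_def cplx_vec_def)
  moreover have "covec_of_form (contract ?Z (imag_form F p)) = cnj_vec (snd u)"
    using arg_cong[OF u(2), of snd] by (simp add: exp_B_def gconj_def)
  ultimately have "cpair (covec_of_form (contract ?Z (imag_form F p))) ?W' = 0"
    using cpair_matched_pair[of M J' H' B', OF B' u(1) Z(2)] by simp
  then show ?thesis
    unfolding cpair_contract_imag_form[OF F] using bilinear_rneg[OF smooth_tensor_bilinear[OF smooth_form_tensor[OF F]]]
    by (simp add: complex_eq_iff)
qed

section \<open>Coincidence of the two metrics and the resulting generalized Kaehler
  structure\<close>

theorem theorem1p13:
  fixes M :: "('m::{t2_space,second_countable_topology}, 'n::finite) atlas"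
    and I\<^sub>p I\<^sub>m :: "'m \<Rightarrow> real^'n \<Rightarrow> real^'n"
    and Hp Hm :: "('m, 'n, complex) tensor"
    and Ap Bp Am Bm :: "'m \<Rightarrow> 'n gvector set"
    and F1 F2 Fp Fm \<omega>p \<omega>m \<beta>p \<beta>m gp gm bp bm H :: "('m, 'n, real) tensor"
  assumes M: "smooth_atlas M"
    and complex_p: "complex_structure M I\<^sub>p"
    and complex_m: "complex_structure M I\<^sub>m"
    and triple_p: "holomorphic_Manin_triple M I\<^sub>p Hp Ap Bp"
    and triple_m: "holomorphic_Manin_triple M I\<^sub>m Hm Am Bm"
    and F1: "smooth_form M 2 F1"
    and F2: "smooth_form M 2 F2"
    and dF1: "(\<lambda>p vs. Hp p vs - Hm p vs) = ext_d M (imag_form F1)"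
    and dF2: "(\<lambda>p vs. cnj (Hm p vs) - Hp p vs) = ext_d M (imag_form F2)"
    and L_A: "\<forall>p. matched_pair I\<^sub>p Ap p = exp_B (imag_form F1 p) ` matched_pair I\<^sub>m Am p"
    and L_B: "\<forall>p. gconj ` matched_pair I\<^sub>m Bm p = exp_B (imag_form F2 p) ` matched_pair I\<^sub>p Bp p"
    and Fp: "Fp = (\<lambda>p vs. (- F1 p vs + F2 p vs) / 2)"
    and Fm: "Fm = (\<lambda>p vs. (- F1 p vs - F2 p vs) / 2)"
    and \<omega>p: "\<omega>p = (\<lambda>p vs. (Fp p vs + conjugate_by I\<^sub>p Fp p vs) / 2)"
    and \<omega>m: "\<omega>m = (\<lambda>p vs. (Fm p vs + conjugate_by I\<^sub>m Fm p vs) / 2)"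
    and \<beta>p: "\<beta>p = (\<lambda>p vs. (Fp p vs - conjugate_by I\<^sub>p Fp p vs) / 2)"
    and \<beta>m: "\<beta>m = (\<lambda>p vs. (Fm p vs - conjugate_by I\<^sub>m Fm p vs) / 2)"
    and gp: "gp = sym_part (\<lambda>p vs. - precomp Fp I\<^sub>p p vs)"
    and bp: "bp = skew_part (\<lambda>p vs. - precomp Fp I\<^sub>p p vs)"
    and gm: "gm = sym_part (\<lambda>p vs. - precomp Fm I\<^sub>m p vs)"
    and bm: "bm = skew_part (\<lambda>p vs. - precomp Fm I\<^sub>m p vs)"
    and H: "H = (\<lambda>p vs. Re (Hp p vs) - ext_d M bp p vs)"
  shows
    "of_real_form \<omega>p = type_part I\<^sub>p 1 1 (of_real_form Fp) \<and>
     of_real_form \<omega>m = type_part I\<^sub>m 1 1 (of_real_form Fm) \<and>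
     of_real_form \<beta>p = (\<lambda>p vs. type_part I\<^sub>p 2 0 (of_real_form Fp) p vs
       + type_part I\<^sub>p 0 2 (of_real_form Fp) p vs) \<and>
     of_real_form \<beta>m = (\<lambda>p vs. type_part I\<^sub>m 2 0 (of_real_form Fm) p vs
       + type_part I\<^sub>m 0 2 (of_real_form Fm) p vs) \<and>
     gp = (\<lambda>p vs. - precomp \<omega>p I\<^sub>p p vs) \<and> bp = (\<lambda>p vs. - precomp \<beta>p I\<^sub>p p vs) \<and>
     gm = (\<lambda>p vs. - precomp \<omega>m I\<^sub>m p vs) \<and> bm = (\<lambda>p vs. - precomp \<beta>m I\<^sub>m p vs) \<and>
     gp = gm \<and> bp = (\<lambda>p vs. - bm p vs) \<and>
     H = (\<lambda>p vs. Re (Hm p vs) - ext_d M bp p vs) \<and>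
     d_c M I\<^sub>p (of_real_form \<omega>p) = of_real_form H \<and>
     (\<lambda>p vs. - d_c M I\<^sub>m (of_real_form \<omega>m) p vs) = of_real_form H \<and>
     (positive_definite gp \<longrightarrow> generalized_Kaehler M gp I\<^sub>p I\<^sub>m H)"
proof -
  have J: "linear (I\<^sub>p p)" "linear (I\<^sub>m p)" for p
    using complex_structure_linear complex_p complex_m by blast+
  have cf: "courant_form M I\<^sub>p Hp" "courant_form M I\<^sub>m Hm"
    and dirac: "holomorphic_Dirac M I\<^sub>p Hp Ap" "holomorphic_Dirac M I\<^sub>p Hp Bp"
      "holomorphic_Dirac M I\<^sub>m Hm Am" "holomorphic_Dirac M I\<^sub>m Hm Bm"
    using triple_p triple_m by (simp_all add: holomorphic_Manin_triple_def)
  note t = smooth_form_tensor[OF F1] smooth_form_tensor[OF F2]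
  have Fp': "Fp = (\<lambda>p vs. (-1/2) *\<^sub>R F1 p vs + (1/2) *\<^sub>R F2 p vs)"
    and Fm': "Fm = (\<lambda>p vs. (-1/2) *\<^sub>R F1 p vs + (-1/2) *\<^sub>R F2 p vs)"
    by (auto simp: Fp Fm field_simps)
  have sFp: "smooth_form M 2 Fp" and sFm: "smooth_form M 2 Fm"
    unfolding Fp' Fm' by (rule smooth_form_lincomb[OF M F1 F2])+
  have dFp: "ext_d M Fp p vs = (- ext_d M F1 p vs + ext_d M F2 p vs) / 2"
    and dFm: "ext_d M Fm p vs = (- ext_d M F1 p vs - ext_d M F2 p vs) / 2" for p vs
    unfolding Fp' Fm' ext_d_lincomb[OF M t] by (simp_all add: field_simps)
  have bl: "bounded_linear (\<lambda>x. \<i> * complex_of_real x)"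
    by (intro bounded_linear_const_mult bounded_linear_of_real)
  have "Hp p vs - Hm p vs = \<i> * ext_d M F1 p vs" "cnj (Hm p vs) - Hp p vs = \<i> * ext_d M F2 p vs" for p vs
    using fun_cong[OF fun_cong[OF dF1], of p vs] fun_cong[OF fun_cong[OF dF2], of p vs]
      ext_d_bounded_linear[OF M bl t(1), of p vs] ext_d_bounded_linear[OF M bl t(2), of p vs]
    by (simp_all add: imag_form_def)
  \<comment> \<open>The right-hand sides are purely imaginary since \<open>F1\<close> and
    \<open>F2\<close> are real: real parts give the equality of the two forms, imaginary parts give
    the exterior derivatives.\<close>
  then have Re: "Re (Hp p vs) = Re (Hm p vs)" and Im: "Im (Hp p vs) - Im (Hm p vs) = ext_d M F1 p vs"
    "- Im (Hm p vs) - Im (Hp p vs) = ext_d M F2 p vs" for p vs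
    by (simp_all add: complex_eq_iff)
  \<comment> \<open>The factors \<open>- 1\<close> and \<open>- (- 1)\<close> are left unsimplified
    to match \<open>- s\<close> with \<open>s = 1\<close> and \<open>s = -1\<close>.\<close>
  have imp: "ext_d M Fp p vs = - 1 * Im (Hp p vs)" and imm: "ext_d M Fm p vs = - (- 1) * Im (Hm p vs)" for p vs
    unfolding dFp dFm Im[symmetric] by simp_all

  have F1J: "F1 p [I\<^sub>p p v, w] = - F1 p [v, I\<^sub>m p w]" for p v w
    using matched_pair_exp_B[OF complex_p complex_m dirac(1,3) F1] L_A by blast
  have F2J: "F2 p [I\<^sub>p p v, w] = F2 p [v, I\<^sub>m p w]" for p v w
    using matched_pair_gconj_exp_B[OF complex_p complex_m dirac(2,4) F2] L_B by blast
  \<comment> \<open>\<open>rev\<close> transposes a bilinear form. The two maps are thus transposes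
    of each other, so their symmetric parts agree and their skew parts are opposite.\<close>
  have cross: "precomp Fp I\<^sub>p p vs = precomp Fm I\<^sub>m p (rev vs)" for p vs
  proof (cases "length vs = 2")
    case True
    then obtain v w where vs: "vs = [v, w]" by (rule length_2E)
    show ?thesis
      using F1J[of p v w] F2J[of p v w] smooth_form_skew[OF F1, of p v "I\<^sub>m p w"] smooth_form_skew[OF F2, of p v "I\<^sub>m p w"]
      by (simp add: vs precomp_def Fp Fm)
  next
    case False
    then show ?thesis
      unfolding precomp_twist[OF smooth_form_tensor[OF sFp]] precomp_twist[OF smooth_form_tensor[OF sFm]]
      by (simp add: twist_def)
  qed
  have gg: "gp = gm" and bb: "bp = (\<lambda>p vs. - bm p vs)"
    unfolding gp gm bp bm by (auto intro!: ext simp: sym_part_def skew_part_def cross field_simps)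

  note p = complex_p sFp and m = complex_m sFm
  have bp_form: "smooth_form M 2 bp" and bm_form: "smooth_form M 2 bm"
    unfolding bp bm by (rule smooth_form_skew_part[OF M p] smooth_form_skew_part[OF M m])+
  have dbp: "ext_d M bp p vs = - ext_d M bm p vs" for p vs
    unfolding bb using ext_d_bounded_linear[OF M bounded_linear_minus[OF bounded_linear_ident] smooth_form_tensor[OF bm_form]] .
  have dcp: "d_c M I\<^sub>p (of_real_form \<omega>p) = of_real_form H"
    unfolding H \<omega>p bp using d_c_form_11[OF M p cf(1) imp] by simp
  have dcm: "(\<lambda>p vs. - d_c M I\<^sub>m (of_real_form \<omega>m) p vs) = of_real_form H"
  proof -
    have "d_c M I\<^sub>m (of_real_form \<omega>m) = of_real_form (\<lambda>p vs. - 1 * Re (Hm p vs) - ext_d M bm p vs)"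
      unfolding \<omega>m bm by (rule d_c_form_11[OF M m cf(2) imm])
    then show ?thesis by (simp add: H of_real_form_def Re dbp add.commute)
  qed

  have gk: "generalized_Kaehler M gp I\<^sub>p I\<^sub>m H" if pos: "positive_definite gp"
    unfolding generalized_Kaehler_def Riemannian_metric_def
  proof (intro conjI allI pos complex_p complex_m)
    show "smooth_tensor M 2 gp" unfolding gp by (rule smooth_tensor_sym_part[OF M p])
    show "gp p [v, w] = gp p [w, v]" for p v w by (simp add: gp sym_part_def)
    show "gp p [I\<^sub>p p v, I\<^sub>p p w] = gp p [v, w]" for p v w
      unfolding gp by (rule sym_part_invariant[OF M p])
    \<comment> \<open>Through \<open>gp = gm\<close> the metric is also the symmetric part built
      from \<open>Fm\<close>, which makes it Hermitian for the second structure.\<close>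
    show "gp p [I\<^sub>m p v, I\<^sub>m p w] = gp p [v, w]" for p v w
      unfolding gg gm by (rule sym_part_invariant[OF M m])
    note Hp_form = courant_form_smooth[OF M cf(1)]
    have ReHp: "smooth_form M 3 (\<lambda>p vs. Re (Hp p vs))"
      by (rule smooth_form_bounded_linear[OF M bounded_linear_Re Hp_form])
    note dbp_form = smooth_form_ext_d[OF M bp_form]
    have H': "H = (\<lambda>p vs. 1 *\<^sub>R Re (Hp p vs) + (-1) *\<^sub>R ext_d M bp p vs)" by (simp add: H)
    show "smooth_form M 3 H"
      unfolding H' by (rule smooth_form_lincomb[OF M ReHp dbp_form])
    \<comment> \<open>\<open>Hp\<close> is closed as part of the Courant algebroid data, taking real
      parts commutes with \<open>ext_d\<close>, and the remaining term is exact.\<close>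
    show "closed_form M H"
      using cf(1) closed_form_ext_d[OF M bp_form]
      unfolding H' closed_form_def courant_form_def
      by (simp only: ext_d_lincomb[OF M smooth_form_tensor[OF ReHp] smooth_form_tensor[OF dbp_form]]
          ext_d_bounded_linear[OF M bounded_linear_Re smooth_form_tensor[OF Hp_form]]) simp
    \<comment> \<open>The fundamental form of the metric is \<omega>: gJ = \<omega> by
      \<open>precomp_sym_part\<close>.\<close>
    show "d_c M I\<^sub>p (of_real_form (precomp gp I\<^sub>p)) = of_real_form H"
      using dcp precomp_sym_part[OF M p] by (simp add: gp \<omega>p)
    show "(\<lambda>p vs. - d_c M I\<^sub>m (of_real_form (precomp gp I\<^sub>m)) p vs) = of_real_form H"
      using dcm precomp_sym_part[OF M m] by (simp add: gg gm \<omega>m)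
  qed
  have type_p: "of_real_form \<omega>p = type_part I\<^sub>p 1 1 (of_real_form Fp)"
    "of_real_form \<beta>p = (\<lambda>p vs. type_part I\<^sub>p 2 0 (of_real_form Fp) p vs + type_part I\<^sub>p 0 2 (of_real_form Fp) p vs)"
    unfolding \<omega>p \<beta>p
    by (intro ext type_part_real_11[where J = "I\<^sub>p", OF M J(1) smooth_form_tensor[OF sFp], symmetric]
        type_part_real_20_02[where J = "I\<^sub>p", OF M J(1) smooth_form_tensor[OF sFp], symmetric])+
  have type_m: "of_real_form \<omega>m = type_part I\<^sub>m 1 1 (of_real_form Fm)"
    "of_real_form \<beta>m = (\<lambda>p vs. type_part I\<^sub>m 2 0 (of_real_form Fm) p vs + type_part I\<^sub>m 0 2 (of_real_form Fm) p vs)"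
    unfolding \<omega>m \<beta>m
    by (intro ext type_part_real_11[where J = "I\<^sub>m", OF M J(2) smooth_form_tensor[OF sFm], symmetric]
        type_part_real_20_02[where J = "I\<^sub>m", OF M J(2) smooth_form_tensor[OF sFm], symmetric])+
  have parts_p: "gp = (\<lambda>p vs. - precomp \<omega>p I\<^sub>p p vs)" "bp = (\<lambda>p vs. - precomp \<beta>p I\<^sub>p p vs)"
    unfolding gp bp \<omega>p \<beta>p by (rule sym_part_precomp[OF M p] skew_part_precomp[OF M p])+
  have parts_m: "gm = (\<lambda>p vs. - precomp \<omega>m I\<^sub>m p vs)" "bm = (\<lambda>p vs. - precomp \<beta>m I\<^sub>m p vs)"
    unfolding gm bm \<omega>m \<beta>m by (rule sym_part_precomp[OF M m] skew_part_precomp[OF M m])+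
  have "H = (\<lambda>p vs. Re (Hm p vs) - ext_d M bp p vs)"
    unfolding H Re ..
  with type_p type_m parts_p parts_m gg bb dcp dcm gk show ?thesis by metis
qed

end
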